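(* Let $n\ge1$ and let $q\in\mathbb C$ be generic. On the quantum group $\mathrm{GL}_{q,-q^{-1}}(2n)$, with generator matrix $A=(a_{ij})_{1\le i,j\le 2n}$, one has $$\mathrm{Pf}_q\big(A^T\,\mathbb J_{-q}\,A\big)=\mathrm{Hf}_q\big(A\,\mathbb J_q\,A^T\big)=\mathrm{rdet}_q(A).$$
   Context: Generic means: $q$ is nonzero and not a root of unity. $\mathcal A_{q,-q^{-1}}(N)$ is the unital associative $\mathbb C$-algebra generated by $a_{ij}$, $1\le i,j\le N$, subject to the following relations with $r=q$, $s=-q^{-1}$, for all $i<j$ and $k<l$ (the first for every row $i$, the second for every column $k$): $a_{ik}a_{il}=r\,a_{il}a_{ik}$; $a_{ik}a_{jk}=s^{-1}a_{jk}a_{ik}$; $r\,a_{il}a_{jk}=s^{-1}a_{jk}a_{il}$; $a_{ik}a_{jl}-a_{jl}a_{ik}=(r-s)a_{il}a_{jk}$. The quantum row-determinant is $\mathrm{rdet}_q(A)=\sum_{\sigma\in S_N}(-q)^{l(\sigma)}a_{1,\sigma(1)}\cdots a_{N,\sigma(N)}$, where $l(\sigma)$ is the number of inversions of $\sigma$. $\mathrm{GL}_{q,-q^{-1}}(N)$ is the localization $\mathcal A_{q,-q^{-1}}(N)[\mathrm{rdet}_q(A)^{-1}]$ obtained by adjoining a two-sided inverse of $\mathrm{rdet}_q(A)$. $\mathbb J_v$ is the $2n\times 2n$ block-diagonal matrix $\mathrm{diag}(J_v,\dots,J_v)$ with $n$ blocks $J_v=\begin{pmatrix}0&1\\-v&0\end{pmatrix}$.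 For a $2n\times 2n$ matrix $B=(b_{ij})$ with entries in an associative $\mathbb C$-algebra, the quantum Pfaffian and quantum Hafnian are $$\mathrm{Pf}_q(B)=\frac1{[n]_{q^4}!}\sum_{\sigma\in\Pi'}(-q)^{l(\sigma)}b_{\sigma(1)\sigma(2)}\cdots b_{\sigma(2n-1)\sigma(2n)},\qquad \mathrm{Hf}_q(B)=\frac1{[n]_{q^4}!}\sum_{\sigma\in\Pi'}q^{l(\sigma)}b_{\sigma(1)\sigma(2)}\cdots b_{\sigma(2n-1)\sigma(2n)},$$ where $\Pi'$ is the set of $\sigma\in S_{2n}$ with $\sigma(2i-1)<\sigma(2i)$ for $i=1,\dots,n$, and $[n]_u!=[n]_u\cdots[1]_u$, $[k]_u=1+u+\cdots+u^{k-1}$. *)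

theory Defs
  imports
    Complex_Main
    "HOL-Algebra.QuotRing"
    "HOL-Algebra.Module"
    "HOL-Library.Poly_Mapping"
    "HOL-Combinatorics.Permutations"
begin

section \<open>Algebras given by generators and relations\<close>

text \<open>
  Words form a monoid under concatenation, so that the convolution product on
  \<^typ>\<open>'x list \<Rightarrow>\<^sub>0 complex\<close> is the product of the free associative algebra.
\<close>

instantiation list :: (type) monoid_add
begin
definition zero_list :: "'a list" where "zero_list = []"
definition plus_list :: "'a list \<Rightarrow> 'a list \<Rightarrow> 'a list" where "plus_list = (@)"
instance by standard (simp_all add: zero_list_def plus_list_def)
end

definition fa_scale :: "complex \<Rightarrow> ('x list \<Rightarrow>\<^sub>0 complex) \<Rightarrow> ('x list \<Rightarrow>\<^sub>0 complex)" where
  "fa_scale c p = Poly_Mapping.map ((*) c) p"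

definition free_alg :: "'x set \<Rightarrow> (complex, 'x list \<Rightarrow>\<^sub>0 complex) module" where
  "free_alg X =
    \<lparr>carrier = {p. \<forall>w \<in> Poly_Mapping.keys p. set w \<subseteq> X},
     monoid.mult = (*), one = 1, zero = 0, add = (+), smult = fa_scale\<rparr>"

definition fa_gen :: "'x \<Rightarrow> ('x list \<Rightarrow>\<^sub>0 complex)" where
  "fa_gen x = Poly_Mapping.single [x] 1"

text \<open>
  The quotient of an algebra by the two-sided ideal generated by a set \<open>S\<close>.  The scalar
  action on a coset is written as a union over representatives; all members of that union agree.
\<close>

definition alg_quot :: "('c, 'a) module \<Rightarrow> 'a set \<Rightarrow> ('c, 'a set) module" where
  "alg_quot M S =
    (let I = genideal M S in
     ring.extend (M Quot I)
       (module.fields (\<lambda>c Y. \<Union>y\<in>Y. I +>\<^bsub>M\<^esub> (c \<odot>\<^bsub>M\<^esub> y))))"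

section \<open>Matrices with entries in an algebra\<close>

text \<open>
  An \<open>N \<times> N\<close> matrix is a function of two indices, of which only the values at
  indices in \<open>{1..N}\<close> are relevant.
\<close>

definition mat_mult ::
  "('c, 'a) module \<Rightarrow> nat \<Rightarrow> (nat \<Rightarrow> nat \<Rightarrow> 'a) \<Rightarrow> (nat \<Rightarrow> nat \<Rightarrow> 'a) \<Rightarrow> nat \<Rightarrow> nat \<Rightarrow> 'a" where
  "mat_mult M N X Y = (\<lambda>i j. \<Oplus>\<^bsub>M\<^esub>k\<in>{1..N}. X i k \<otimes>\<^bsub>M\<^esub> Y k j)"

definition mat_transpose :: "(nat \<Rightarrow> nat \<Rightarrow> 'a) \<Rightarrow> nat \<Rightarrow> nat \<Rightarrow> 'a" where
  "mat_transpose X = (\<lambda>i j. X j i)"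

definition scalar_mat :: "('c, 'a) module \<Rightarrow> (nat \<Rightarrow> nat \<Rightarrow> 'c) \<Rightarrow> nat \<Rightarrow> nat \<Rightarrow> 'a" where
  "scalar_mat M V = (\<lambda>i j. V i j \<odot>\<^bsub>M\<^esub> \<one>\<^bsub>M\<^esub>)"

text \<open>The block-diagonal matrix with diagonal blocks having rows \<open>(0, 1)\<close> and \<open>(-v, 0)\<close>.\<close>

definition J_mat :: "complex \<Rightarrow> nat \<Rightarrow> nat \<Rightarrow> complex" where
  "J_mat v i j = (if odd i \<and> j = i + 1 then 1 else if even i \<and> i = j + 1 then - v else 0)"

definition ordered_prod :: "('c, 'a) module \<Rightarrow> 'a list \<Rightarrow> 'a" where
  "ordered_prod M xs = foldr (\<lambda>x y. x \<otimes>\<^bsub>M\<^esub> y) xs \<one>\<^bsub>M\<^esub>"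

section \<open>Quantum determinant, Pfaffian and Hafnian\<close>

definition num_inversions :: "nat \<Rightarrow> (nat \<Rightarrow> nat) \<Rightarrow> nat" where
  "num_inversions N \<sigma> = card {(i, j). i \<in> {1..N} \<and> j \<in> {1..N} \<and> i < j \<and> \<sigma> i > \<sigma> j}"

definition rdet ::
  "complex \<Rightarrow> (complex, 'a) module \<Rightarrow> nat \<Rightarrow> (nat \<Rightarrow> nat \<Rightarrow> 'a) \<Rightarrow> 'a" where
  "rdet q M N A =
    (\<Oplus>\<^bsub>M\<^esub>\<sigma>\<in>{\<sigma>. \<sigma> permutes {1..N}}.
       (- q) ^ num_inversions N \<sigma> \<odot>\<^bsub>M\<^esub> ordered_prod M (map (\<lambda>i. A i (\<sigma> i)) [1..<N + 1]))"

definition q_number :: "complex \<Rightarrow> nat \<Rightarrow> complex" where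
  "q_number u k = (\<Sum>i<k. u ^ i)"

definition q_factorial :: "complex \<Rightarrow> nat \<Rightarrow> complex" where
  "q_factorial u n = (\<Prod>k=1..n. q_number u k)"

definition pair_perms :: "nat \<Rightarrow> (nat \<Rightarrow> nat) set" where
  "pair_perms n = {\<sigma>. \<sigma> permutes {1..2 * n} \<and> (\<forall>i\<in>{1..n}. \<sigma> (2 * i - 1) < \<sigma> (2 * i))}"

definition q_Pfaffian ::
  "complex \<Rightarrow> (complex, 'a) module \<Rightarrow> nat \<Rightarrow> (nat \<Rightarrow> nat \<Rightarrow> 'a) \<Rightarrow> 'a" where
  "q_Pfaffian q M n B =
    (1 / q_factorial (q ^ 4) n) \<odot>\<^bsub>M\<^esub>
      (\<Oplus>\<^bsub>M\<^esub>\<sigma>\<in>pair_perms n.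
         (- q) ^ num_inversions (2 * n) \<sigma> \<odot>\<^bsub>M\<^esub>
           ordered_prod M (map (\<lambda>i. B (\<sigma> (2 * i - 1)) (\<sigma> (2 * i))) [1..<n + 1]))"

definition q_Hafnian ::
  "complex \<Rightarrow> (complex, 'a) module \<Rightarrow> nat \<Rightarrow> (nat \<Rightarrow> nat \<Rightarrow> 'a) \<Rightarrow> 'a" where
  "q_Hafnian q M n B =
    (1 / q_factorial (q ^ 4) n) \<odot>\<^bsub>M\<^esub>
      (\<Oplus>\<^bsub>M\<^esub>\<sigma>\<in>pair_perms n.
         q ^ num_inversions (2 * n) \<sigma> \<odot>\<^bsub>M\<^esub>
           ordered_prod M (map (\<lambda>i. B (\<sigma> (2 * i - 1)) (\<sigma> (2 * i))) [1..<n + 1]))"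

section \<open>The quantum group\<close>

definition generic :: "complex \<Rightarrow> bool" where
  "generic q \<longleftrightarrow> q \<noteq> 0 \<and> (\<forall>k\<ge>1. q ^ k \<noteq> 1)"

datatype gl_gen = Entry nat nat | DetInv

abbreviation fa_entry :: "nat \<Rightarrow> nat \<Rightarrow> (gl_gen list \<Rightarrow>\<^sub>0 complex)" where
  "fa_entry i j \<equiv> fa_gen (Entry i j)"

text \<open>A relation \<open>u = v\<close> is represented by the relator \<open>u - v\<close>.\<close>

definition qmat_relators :: "complex \<Rightarrow> complex \<Rightarrow> nat \<Rightarrow> (gl_gen list \<Rightarrow>\<^sub>0 complex) set" where
  "qmat_relators r s N =
    (let a = fa_entry; D = {1..N} in
      {a i k * a i l - fa_scale r (a i l * a i k) | i k l.
         i \<in> D \<and> k \<in> D \<and> l \<in> D \<and> k < l}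
    \<union> {a i k * a j k - fa_scale (inverse s) (a j k * a i k) | i j k.
         i \<in> D \<and> j \<in> D \<and> k \<in> D \<and> i < j}
    \<union> {fa_scale r (a i l * a j k) - fa_scale (inverse s) (a j k * a i l) | i j k l.
         i \<in> D \<and> j \<in> D \<and> k \<in> D \<and> l \<in> D \<and> i < j \<and> k < l}
    \<union> {(a i k * a j l - a j l * a i k) - fa_scale (r - s) (a i l * a j k) | i j k l.
         i \<in> D \<and> j \<in> D \<and> k \<in> D \<and> l \<in> D \<and> i < j \<and> k < l})"

text \<open>
  The localization of the quantum matrix algebra at the row-determinant is presented by the
  matrix entries, one further generator \<open>DetInv\<close>, the quantum matrix relations and the two
  relations making \<open>DetInv\<close> a two-sided inverse of the determinant.
\<close>

definition gl_gens :: "nat \<Rightarrow> gl_gen set" where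
  "gl_gens N = {Entry i j | i j. i \<in> {1..N} \<and> j \<in> {1..N}} \<union> {DetInv}"

definition gl_relators :: "complex \<Rightarrow> nat \<Rightarrow> (gl_gen list \<Rightarrow>\<^sub>0 complex) set" where
  "gl_relators q N =
    (let d = rdet q (free_alg (gl_gens N)) N fa_entry; t = fa_gen DetInv in
      qmat_relators q (- inverse q) N \<union> {d * t - 1, t * d - 1})"

definition GL_q :: "complex \<Rightarrow> nat \<Rightarrow> (complex, (gl_gen list \<Rightarrow>\<^sub>0 complex) set) module" where
  "GL_q q N = alg_quot (free_alg (gl_gens N)) (gl_relators q N)"

definition GL_entry :: "complex \<Rightarrow> nat \<Rightarrow> nat \<Rightarrow> nat \<Rightarrow> (gl_gen list \<Rightarrow>\<^sub>0 complex) set" where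
  "GL_entry q N i j =
    genideal (free_alg (gl_gens N)) (gl_relators q N) +>\<^bsub>free_alg (gl_gens N)\<^esub> fa_entry i j"

end

(*
  Adjoin to the quantum matrix algebra letters x_1, ..., x_N commuting with it and satisfying
  x_j x_i = -q x_i x_j (i < j), x_i^2 = 0.  The forms d_i = sum_k a_ik x_k satisfy the same relations,
  so d_1 ... d_N = rdet(A) x_1 ... x_N, and Omega = sum_m d_(2m-1) d_(2m) equals
  sum_(k<l) b_kl x_k x_l with b the entries of A^T J A.  The summands of Omega q^4-commute and square
  to zero, so Omega^n = [n]_(q^4)! d_1 ... d_2n, while expanding in the b_kl gives the Pfaffian sum.

  Transposition turns the relations for q into those for -q, so the Hafnian of A J A^T is the
  Pfaffian for (-q, A^T) and equals rdet_(-q)(A^T).  With letters y_i such that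
  y_j y_i = q y_i y_j, the N-th power of sum_(i,k) a_ik x_k y_i is both [N]_u! rdet_q(A) and
  [N]_u! rdet_(-q)(A^T) times x_1 ... x_N y_1 ... y_N, where u = -q^2; hence the two agree.
*)
theory Submission
  imports Defs
begin

section \<open>Congruence modulo an ideal\<close>

text \<open>The obstacle is that letters are adjoined to an algebra that is itself a quotient
  depending on \<open>q\<close> and \<open>N\<close>, hence not a type. All computation therefore
  takes place in type-class rings modulo an ideal \<open>I\<close>, and \<open>scalar_ideal\<close>
  records just enough to be instantiated again for word polynomials over the same ring: once for the
  Pfaffian and twice, nested, for the transposition. Comparing coefficients of x_1 ... x_N rests on
  no basis theorem, neither for the quantum matrix algebra nor for the letters: a functional on
  unordered polynomials that respects the letter relations suffices. The parameter of J is forced.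
  In d_(2m-1) d_(2m) the coefficient of x_k x_l (k < l) is a_(2m-1,k) a_(2m,l) - q a_(2m-1,l)
  a_(2m,k); since a_(2m-1,l) a_(2m,k) = - a_(2m,k) a_(2m-1,l), the two terms acquire the
  coefficients 1 and q, the nonzero entries of the block J_(-q). That q is no root of unity permits
  division by [n]_(q^4)! and by [2n]_u! with u = -q^2.\<close>

locale scalar_ideal =
  fixes sc :: "complex \<Rightarrow> 'a::ring_1" and I :: "'a set"
  assumes sc_one [simp]: "sc 1 = 1"
    and sc_add: "sc (c + d) = sc c + sc d"
    and sc_mult: "sc (c * d) = sc c * sc d"
    and sc_comm: "sc c * x = x * sc c"
    and zero_in [simp]: "0 \<in> I"
    and add_in: "x \<in> I \<Longrightarrow> y \<in> I \<Longrightarrow> x + y \<in> I"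
    and lmult_in: "x \<in> I \<Longrightarrow> y * x \<in> I"
    and rmult_in: "x \<in> I \<Longrightarrow> x * y \<in> I"
begin

definition eqv :: "'a \<Rightarrow> 'a \<Rightarrow> bool" (infix \<open>\<approx>\<close> 50) where
  "x \<approx> y \<longleftrightarrow> x - y \<in> I"

lemma sc_zero [simp]: "sc 0 = 0"
  using sc_add[of 0 0] by simp

lemma sc_minus: "sc (- c) = - sc c"
  using sc_add[of c "- c"] by (simp add: eq_neg_iff_add_eq_0 add.commute)

lemma sc_lcomm: "x * (sc c * y) = sc c * (x * y)"
  by (metis sc_comm mult.assoc)

lemma minus_in: "x \<in> I \<Longrightarrow> - x \<in> I"
  using lmult_in[of x "- 1"] by simp

lemma eqv_refl [simp]: "x \<approx> x"
  by (simp add: eqv_def)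

lemma eqv_sym: "x \<approx> y \<Longrightarrow> y \<approx> x"
  using minus_in[of "x - y"] by (simp add: eqv_def)

lemma eqv_trans [trans]: "x \<approx> y \<Longrightarrow> y \<approx> z \<Longrightarrow> x \<approx> z"
  using add_in[of "x - y" "y - z"] by (simp add: eqv_def)

lemma eqv_add: "x \<approx> y \<Longrightarrow> x' \<approx> y' \<Longrightarrow> x + x' \<approx> y + y'"
  using add_in[of "x - y" "x' - y'"] by (simp add: eqv_def algebra_simps)

lemma eqv_minus: "x \<approx> y \<Longrightarrow> - x \<approx> - y"
  using minus_in[of "x - y"] by (simp add: eqv_def algebra_simps)

lemma eqv_diff: "x \<approx> y \<Longrightarrow> x' \<approx> y' \<Longrightarrow> x - x' \<approx> y - y'"
  using eqv_add[of x y "- x'" "- y'"] eqv_minus by simp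

lemma eqv_lmult: "x \<approx> y \<Longrightarrow> z * x \<approx> z * y"
  using lmult_in[of "x - y" z] by (simp add: eqv_def algebra_simps)

lemma eqv_rmult: "x \<approx> y \<Longrightarrow> x * z \<approx> y * z"
  using rmult_in[of "x - y" z] by (simp add: eqv_def algebra_simps)

lemma eqv_mult: "x \<approx> y \<Longrightarrow> x' \<approx> y' \<Longrightarrow> x * x' \<approx> y * y'"
  by (meson eqv_lmult eqv_rmult eqv_trans)

lemma eqv_sum: "(\<And>i. i \<in> S \<Longrightarrow> f i \<approx> g i) \<Longrightarrow> sum f S \<approx> sum g S"
  by (induction S rule: infinite_finite_induct) (simp_all add: eqv_add)

lemma eqv_power: "x \<approx> y \<Longrightarrow> x ^ k \<approx> y ^ k"
  by (induction k) (simp_all add: eqv_mult)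

lemma eqv_cancel_sc:
  assumes "sc c * x \<approx> sc c * y" "c \<noteq> 0"
  shows "x \<approx> y"
proof -
  have "sc (inverse c) * (sc c * z) = z" for z
    using assms(2) by (simp add: mult.assoc[symmetric] sc_mult[symmetric])
  then show ?thesis
    using eqv_lmult[OF assms(1), of "sc (inverse c)"] by simp
qed

text \<open>Since z^2 vanishes, only words in S and z with at most one z survive, and moving that z
  to the right end past j factors S costs u^j.\<close>

lemma sum_power_square_zero:
  assumes comm: "z * S \<approx> sc u * (S * z)" and sq: "z * z \<approx> 0"
  shows "(S + z) ^ Suc k \<approx> S ^ Suc k + sc (q_number u (Suc k)) * (S ^ k * z)"
proof (induction k)
  case 0
  show ?case by (simp add: q_number_def)
next
  case (Suc k)
  let ?c = "sc (q_number u (Suc k))"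
  have "(S + z) ^ Suc (Suc k) = (S + z) ^ Suc k * (S + z)"
    by (rule power_Suc2)
  also have "\<dots> \<approx> (S ^ Suc k + ?c * (S ^ k * z)) * (S + z)"
    by (rule eqv_rmult[OF Suc])
  also have "\<dots> = S ^ Suc (Suc k) + S ^ Suc k * z + ?c * S ^ k * (z * S) + ?c * S ^ k * (z * z)"
    by (simp add: algebra_simps power_commutes)
  also have "\<dots> \<approx> S ^ Suc (Suc k) + S ^ Suc k * z + ?c * S ^ k * (sc u * (S * z)) + ?c * S ^ k * 0"
    by (intro eqv_add eqv_lmult comm sq eqv_refl)
  also have "\<dots> = S ^ Suc (Suc k) + (1 + ?c * sc u) * (S ^ Suc k * z)"
  proof -
    have "S ^ k * (sc u * (S * z)) = sc u * (S ^ Suc k * z)"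
      by (metis sc_lcomm power_Suc2 mult.assoc)
    then show ?thesis by (simp add: algebra_simps)
  qed
  also have "1 + ?c * sc u = sc (q_number u (Suc (Suc k)))"
  proof -
    \<comment> \<open>The recursion [k+1] = 1 + u [k], obtained by splitting off the lowest
      power.\<close>
    have "q_number u (Suc (Suc k)) = 1 + q_number u (Suc k) * u"
      unfolding q_number_def sum.lessThan_Suc_shift[of _ "Suc k"]
      by (simp add: sum_distrib_left mult.commute distrib_left)
    then show ?thesis by (simp add: sc_add sc_mult)
  qed
  finally show ?case .
qed

text \<open>The last summand u-commutes with the partial sum because \<open>u\<close> is the same
  for all pairs, so \<open>sum_power_square_zero\<close> applies each time a summand is
  added.\<close>

theorem q_multinomial:
  fixes z :: "nat \<Rightarrow> 'a"
  assumes comm: "\<And>i j. 1 \<le> i \<Longrightarrow> i < j \<Longrightarrow> j \<le> N \<Longrightarrow> z j * z i \<approx> sc u * (z i * z j)"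
    and sq: "\<And>i. 1 \<le> i \<Longrightarrow> i \<le> N \<Longrightarrow> z i * z i \<approx> 0"
  shows "(\<Sum>i = 1..N. z i) ^ N \<approx> sc (q_factorial u N) * prod_list (map z [1..<N + 1])"
proof -
  \<comment> \<open>The vanishing of the (m+1)-st power is carried along: in the next step it kills
    the term without the new summand.\<close>
  have "(\<Sum>i = 1..m. z i) ^ m \<approx> sc (q_factorial u m) * prod_list (map z [1..<m + 1]) \<and>
        (\<Sum>i = 1..m. z i) ^ Suc m \<approx> 0" if "m \<le> N" for m
    using that
  proof (induction m)
    case 0
    show ?case by (simp add: q_factorial_def)
  next
    case (Suc m)
    let ?S = "\<Sum>i = 1..m. z i" and ?z = "z (Suc m)"
    have S: "(\<Sum>i = 1..Suc m. z i) = ?S + ?z"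
      by simp
    have "?z * ?S = (\<Sum>i = 1..m. ?z * z i)"
      by (simp add: sum_distrib_left)
    also have "\<dots> \<approx> (\<Sum>i = 1..m. sc u * (z i * ?z))"
      by (rule eqv_sum, rule comm) (use Suc.prems in auto)
    also have "\<dots> = sc u * (?S * ?z)"
      by (simp add: sum_distrib_left sum_distrib_right)
    finally have c: "?z * ?S \<approx> sc u * (?S * ?z)" .
    have s: "?z * ?z \<approx> 0"
      by (rule sq) (use Suc.prems in auto)
    have IH: "?S ^ m \<approx> sc (q_factorial u m) * prod_list (map z [1..<m + 1])" "?S ^ Suc m \<approx> 0"
      using Suc by auto
    have "(?S + ?z) ^ Suc m \<approx> ?S ^ Suc m + sc (q_number u (Suc m)) * (?S ^ m * ?z)"
      by (rule sum_power_square_zero[OF c s])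
    also have "\<dots> \<approx> 0 + sc (q_number u (Suc m)) *
        ((sc (q_factorial u m) * prod_list (map z [1..<m + 1])) * ?z)"
      by (intro eqv_add eqv_lmult eqv_rmult IH)
    also have "\<dots> = sc (q_factorial u (Suc m)) * prod_list (map z [1..<Suc m + 1])"
      by (simp add: q_factorial_def sc_mult mult.assoc)
         (metis mult.assoc sc_comm)
    finally have 1: "(?S + ?z) ^ Suc m \<approx>
      sc (q_factorial u (Suc m)) * prod_list (map z [1..<Suc m + 1])" .
    have "(?S + ?z) ^ Suc (Suc m) \<approx>
        ?S ^ Suc m * ?S + sc (q_number u (Suc (Suc m))) * (?S ^ Suc m * ?z)"
      using sum_power_square_zero[OF c s, of "Suc m"] by (simp only: power_Suc2)
    also have "\<dots> \<approx> 0 * ?S + sc (q_number u (Suc (Suc m))) * (0 * ?z)"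
      by (intro eqv_add eqv_lmult eqv_rmult IH)
    finally have 2: "(?S + ?z) ^ Suc (Suc m) \<approx> 0" by simp
    show ?case unfolding S using 1 2 by blast
  qed
  then show ?thesis by blast
qed

end

text \<open>[k]_u divides u^k - 1.\<close>

lemma q_number_nonzero:
  assumes "\<forall>k\<ge>1. u ^ k \<noteq> 1" "k \<ge> 1"
  shows "q_number u k \<noteq> 0"
proof
  assume "q_number u k = 0"
  then have "u ^ k - 1 = 0"
    by (simp add: power_diff_1_eq q_number_def)
  with assms show False by auto
qed

lemma q_factorial_nonzero:
  assumes "\<forall>k\<ge>1. u ^ k \<noteq> 1"
  shows "q_factorial u n \<noteq> 0"
  using q_number_nonzero[OF assms] by (auto simp: q_factorial_def)

section \<open>Expanding products of sums\<close>

lemma prod_list_sum: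
  fixes f :: "'i \<Rightarrow> 'j \<Rightarrow> 'a::ring_1"
  assumes "finite S"
  shows "prod_list (map (\<lambda>i. \<Sum>j\<in>S. f i j) is) =
    (\<Sum>w | set w \<subseteq> S \<and> length w = length is. prod_list (map2 f is w))"
proof (induction "is")
  case Nil
  have "{w. set w \<subseteq> S \<and> length w = 0} = {[]}" by auto
  then show ?case by simp
next
  case (Cons i "is")
  let ?W = "{w. set w \<subseteq> S \<and> length w = length is}"
  have *: "{w. set w \<subseteq> S \<and> length w = length (i # is)} = (\<lambda>(j, w). j # w) ` (S \<times> ?W)"
    by (auto simp: length_Suc_conv image_iff)
  have inj: "inj_on (\<lambda>(j, w). j # w) (S \<times> ?W)"
    by (auto simp: inj_on_def)
  show ?case
    unfolding * sum.reindex[OF inj]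
    by (simp add: Cons sum_product sum.cartesian_product case_prod_unfold comp_def split_beta')
qed

lemma sum_power_lists:
  fixes f :: "'j \<Rightarrow> 'a::ring_1"
  assumes "finite S"
  shows "(\<Sum>j\<in>S. f j) ^ n = (\<Sum>w | set w \<subseteq> S \<and> length w = n. prod_list (map f w))"
proof -
  have "map2 (\<lambda>_. f) is w = map f w" if "length w = length is" for w and "is" :: "nat list"
    using that by (induction w "is" rule: list_induct2) auto
  then show ?thesis
    using prod_list_sum[OF assms, of "\<lambda>_. f" "[0..<n]"]
    by (simp add: map_replicate_const prod_list_replicate cong: sum.cong_simp)
qed

lemma prod_list_commute:
  fixes x :: "'a::monoid_mult"
  assumes "\<And>y. y \<in> set ys \<Longrightarrow> x * y = y * x"
  shows "x * prod_list ys = prod_list ys * x"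
  using assms by (induction ys) (simp_all, metis mult.assoc)

section \<open>Adjoining quasi-commuting letters\<close>

text \<open>Tailored to additive claims: unlike in \<open>update_induct\<close>, the two summands
  may share keys, so linear maps and ideals are handled directly.\<close>

lemma poly_mapping_sum_induct [case_names zero single add]:
  assumes "P 0" "\<And>k c. P (Poly_Mapping.single k c)" "\<And>f g. P f \<Longrightarrow> P g \<Longrightarrow> P (f + g)"
  shows "P (f :: 'k \<Rightarrow>\<^sub>0 'c::comm_monoid_add)"
proof (induction f rule: update_induct)
  case const
  show ?case by (fact assms(1))
next
  case (update f a b)
  have "Poly_Mapping.update a b f = Poly_Mapping.single a b + f"
    by (rule poly_mapping_eqI)
       (use update(1) in \<open>auto simp: lookup_update lookup_add lookup_single in_keys_iff when_def\<close>)
  then show ?case using assms(2,3) update(3) by metis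
qed

fun list_inv :: "nat list \<Rightarrow> nat" where
  "list_inv [] = 0"
| "list_inv (x # w) = length (filter (\<lambda>y. y < x) w) + list_inv w"

lemma list_inv_swap: "i < j \<Longrightarrow> list_inv (u @ j # i # t) = Suc (list_inv (u @ i # j # t))"
  by (induction u) auto

definition perm_words :: "nat \<Rightarrow> nat list set" where
  "perm_words N = {w. distinct w \<and> set w = {1..N}}"

lemma length_perm_words: "w \<in> perm_words N \<Longrightarrow> length w = N"
  using distinct_card[of w] by (auto simp: perm_words_def)

lemma finite_perm_words: "finite (perm_words N)"
  by (rule finite_subset[OF _ finite_lists_length_eq[of "{1..N}" N]])
     (use length_perm_words[of _ N] in \<open>auto simp: perm_words_def\<close>)

text \<open>The coefficient of x_1 ... x_N after normal ordering \<open>w\<close> by x_j x_i = v x_i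
  x_j (i < j) and x_i^2 = 0: each inversion costs one factor \<open>v\<close>, and words that do not
  use every letter exactly once contribute nothing.\<close>

definition word_weight :: "complex \<Rightarrow> nat \<Rightarrow> nat list \<Rightarrow> complex" where
  "word_weight v N w = (if w \<in> perm_words N then v ^ list_inv w else 0)"

text \<open>Together with \<open>word_weight_square\<close> this says that the weight respects the
  letter relations in every context \<open>u\<close>, \<open>t\<close>; outside
  \<open>perm_words\<close> both sides vanish.\<close>

lemma word_weight_swap:
  "i < j \<Longrightarrow> word_weight v N (u @ j # i # t) = v * word_weight v N (u @ i # j # t)"
proof -
  assume ij: "i < j"
  have "set (u @ j # i # t) = set (u @ i # j # t)" "distinct (u @ j # i # t) = distinct (u @ i # j # t)"
    by auto
  then have "u @ j # i # t \<in> perm_words N \<longleftrightarrow> u @ i # j # t \<in> perm_words N"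
    unfolding perm_words_def by (simp only: mem_Collect_eq)
  then show ?thesis
    by (simp only: word_weight_def list_inv_swap[OF ij] power_Suc mult_zero_right split: if_split) simp
qed

lemma word_weight_square: "word_weight v N (u @ i # i # t) = 0"
  by (simp add: word_weight_def perm_words_def)

context scalar_ideal
begin

text \<open>Polynomials stay unordered. Their product is convolution over words with coefficients in
  the base ring, so letters commute with coefficients by construction, and the letter relations
  enter through the weights.\<close>

definition top_coeff :: "complex \<Rightarrow> nat \<Rightarrow> (nat list \<Rightarrow>\<^sub>0 'a) \<Rightarrow> 'a" where
  "top_coeff v N h = (\<Sum>w\<in>perm_words N. Poly_Mapping.lookup h w * sc (word_weight v N w))"

text \<open>
  Normal ordering of letters need not be constructed: the largest ideal on which the coefficient of
  the top word vanishes modulo \<open>I\<close> already contains the letter relations, and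
  \<open>top_coeff\<close> recovers elements of the base ring from congruences between top-degree elements.
\<close>

definition ext_ideal :: "complex \<Rightarrow> nat \<Rightarrow> (nat list \<Rightarrow>\<^sub>0 'a) set" where
  "ext_ideal v N = {h. \<forall>u t. top_coeff v N
     (Poly_Mapping.single u 1 * h * Poly_Mapping.single t 1) \<in> I}"

lemma top_coeff_zero [simp]: "top_coeff v N 0 = 0"
  by (simp add: top_coeff_def)

lemma top_coeff_add: "top_coeff v N (g + h) = top_coeff v N g + top_coeff v N h"
  by (simp add: top_coeff_def lookup_add distrib_right sum.distrib)

lemma top_coeff_uminus: "top_coeff v N (- h) = - top_coeff v N h"
  by (simp add: top_coeff_def sum_negf)

lemma top_coeff_diff: "top_coeff v N (g - h) = top_coeff v N g - top_coeff v N h"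
  using top_coeff_add[of v N g "- h"] by (simp add: top_coeff_uminus)

lemma top_coeff_sum: "top_coeff v N (sum f S) = (\<Sum>i\<in>S. top_coeff v N (f i))"
  by (induction S rule: infinite_finite_induct) (simp_all add: top_coeff_add)

lemma top_coeff_single: "top_coeff v N (Poly_Mapping.single w r) = r * sc (word_weight v N w)"
proof -
  have "top_coeff v N (Poly_Mapping.single w r) =
      (\<Sum>w'\<in>perm_words N. if w = w' then r * sc (word_weight v N w) else 0)"
    unfolding top_coeff_def by (rule sum.cong) (auto simp: lookup_single)
  also have "\<dots> = r * sc (word_weight v N w)"
    by (auto simp: sum.delta finite_perm_words word_weight_def)
  finally show ?thesis .
qed

lemma top_coeff_scale_left: "top_coeff v N (Poly_Mapping.single 0 r * h) = r * top_coeff v N h"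
  by (induction h rule: poly_mapping_sum_induct)
     (simp_all add: mult_single top_coeff_single distrib_left top_coeff_add mult.assoc)

lemma top_coeff_scale_right: "top_coeff v N (h * Poly_Mapping.single 0 r) = top_coeff v N h * r"
  by (induction h rule: poly_mapping_sum_induct)
     (simp_all add: mult_single top_coeff_single distrib_right top_coeff_add mult.assoc sc_comm)

lemma ext_ideal_top_coeff: "h \<in> ext_ideal v N \<Longrightarrow> top_coeff v N h \<in> I"
  by (simp add: ext_ideal_def, drule spec[of _ 0], drule spec[of _ 0]) simp

text \<open>A factor consisting of one term splits into a word, which is absorbed into the context
  \<open>u\<close> or \<open>t\<close>, and a coefficient, which comes out of
  \<open>top_coeff\<close>.\<close>

lemma ext_scalar_ideal: "scalar_ideal (\<lambda>c. Poly_Mapping.single 0 (sc c)) (ext_ideal v N)"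
proof
  fix c d and x y :: "nat list \<Rightarrow>\<^sub>0 'a"
  show "Poly_Mapping.single 0 (sc 1) = (1 :: nat list \<Rightarrow>\<^sub>0 'a)"
    by simp
  show "Poly_Mapping.single 0 (sc (c + d)) =
      (Poly_Mapping.single 0 (sc c) + Poly_Mapping.single 0 (sc d) :: nat list \<Rightarrow>\<^sub>0 'a)"
    by (simp add: sc_add single_add)
  show "Poly_Mapping.single 0 (sc (c * d)) =
      (Poly_Mapping.single 0 (sc c) * Poly_Mapping.single 0 (sc d) :: nat list \<Rightarrow>\<^sub>0 'a)"
    by (simp add: sc_mult mult_single)
  show "Poly_Mapping.single 0 (sc c) * x = x * Poly_Mapping.single 0 (sc c)"
    by (induction x rule: poly_mapping_sum_induct)
       (simp_all add: mult_single sc_comm algebra_simps)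
  show "0 \<in> ext_ideal v N"
    by (simp add: ext_ideal_def)
  show "x + y \<in> ext_ideal v N" if "x \<in> ext_ideal v N" "y \<in> ext_ideal v N"
    using that by (simp add: ext_ideal_def distrib_left distrib_right top_coeff_add add_in)
  show "y * x \<in> ext_ideal v N" if x: "x \<in> ext_ideal v N"
  proof (induction y rule: poly_mapping_sum_induct)
    case (single k c)
    have "Poly_Mapping.single u 1 * (Poly_Mapping.single k c * x) * Poly_Mapping.single t 1 =
      Poly_Mapping.single 0 c * (Poly_Mapping.single (u + k) 1 * x * Poly_Mapping.single t 1)" for u t
      by (simp add: mult.assoc[symmetric] mult_single)
    then show ?case
      using x by (simp add: ext_ideal_def top_coeff_scale_left lmult_in)
  qed (simp_all add: ext_ideal_def distrib_left distrib_right top_coeff_add add_in)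
  show "x * y \<in> ext_ideal v N" if x: "x \<in> ext_ideal v N"
  proof (induction y rule: poly_mapping_sum_induct)
    case (single k c)
    have "Poly_Mapping.single u 1 * (x * Poly_Mapping.single k c) * Poly_Mapping.single t 1 =
      (Poly_Mapping.single u 1 * x * Poly_Mapping.single (k + t) 1) * Poly_Mapping.single 0 c" for u t
      by (simp add: mult.assoc mult_single)
    then show ?case
      using x by (simp add: ext_ideal_def top_coeff_scale_right rmult_in)
  qed (simp_all add: ext_ideal_def distrib_left distrib_right top_coeff_add add_in)
qed

interpretation ext: scalar_ideal "\<lambda>c. Poly_Mapping.single 0 (sc c)" "ext_ideal v N" for v N
  by (rule ext_scalar_ideal)

abbreviation emb :: "'a \<Rightarrow> (nat list \<Rightarrow>\<^sub>0 'a)" where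
  "emb \<equiv> Poly_Mapping.single 0"

abbreviation letter :: "nat \<Rightarrow> (nat list \<Rightarrow>\<^sub>0 'a)" where
  "letter j \<equiv> Poly_Mapping.single [j] 1"

lemma emb_add: "emb (x + y) = emb x + emb y"
  by (rule single_add)

lemma emb_diff: "emb (x - y) = emb x - emb y"
  by (rule single_diff)

lemma emb_uminus: "emb (- x) = - emb x"
  by (rule single_uminus)

lemma emb_mult: "emb (x * y) = emb x * emb y"
  by (simp add: mult_single)

lemma emb_sum: "emb (sum f S) = (\<Sum>i\<in>S. emb (f i))"
  by (induction S rule: infinite_finite_induct) (simp_all add: emb_add)

lemma emb_prod_list: "emb (prod_list xs) = prod_list (map emb xs)"
  by (induction xs) (simp_all add: emb_mult)

lemma letter_commute: "letter j * emb r = emb r * letter j"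
  by (simp add: mult_single)

lemma prod_list_letters: "prod_list (map letter w) = Poly_Mapping.single w 1"
proof (induction w)
  case Nil
  have "Poly_Mapping.single [] 1 = (1 :: nat list \<Rightarrow>\<^sub>0 'a)"
    by (metis single_one zero_list_def)
  then show ?case by simp
next
  case (Cons j w)
  then show ?case by (simp add: mult_single plus_list_def)
qed

text \<open>In any context the top coefficient of \<open>emb (x - y)\<close> is a scalar multiple of
  \<open>x - y\<close>.\<close>

lemma emb_eqv: "x \<approx> y \<Longrightarrow> ext.eqv v N (emb x) (emb y)"
proof -
  assume "x \<approx> y"
  then have "top_coeff v N (Poly_Mapping.single u 1 * emb (x - y) * Poly_Mapping.single t 1) \<in> I" for u t
    by (simp add: mult_single top_coeff_single eqv_def rmult_in)
  then show ?thesis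
    unfolding ext.eqv_def by (simp add: ext_ideal_def single_diff)
qed

lemma letter_swap:
  assumes "i < j"
  shows "ext.eqv v N (letter j * letter i) (emb (sc v) * (letter i * letter j))"
proof -
  have "top_coeff v N (Poly_Mapping.single u 1 *
      (letter j * letter i - emb (sc v) * (letter i * letter j)) * Poly_Mapping.single t 1) = 0" for u t
    using word_weight_swap[OF assms, of v N u t]
    by (simp add: right_diff_distrib left_diff_distrib mult_single top_coeff_diff top_coeff_single
        plus_list_def zero_list_def sc_mult)
  then show ?thesis
    unfolding ext.eqv_def by (simp add: ext_ideal_def)
qed

lemma letter_square: "ext.eqv v N (letter i * letter i) 0"
proof -
  have "top_coeff v N (Poly_Mapping.single u 1 * (letter i * letter i) * Poly_Mapping.single t 1) = 0" for u t
    using word_weight_square[of v N u i t]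
    by (simp add: mult_single top_coeff_single plus_list_def)
  then show ?thesis
    unfolding ext.eqv_def by (simp add: ext_ideal_def)
qed

lemma top_coeff_eqv: "ext.eqv v N g h \<Longrightarrow> top_coeff v N g \<approx> top_coeff v N h"
  using ext_ideal_top_coeff by (force simp: ext.eqv_def eqv_def top_coeff_diff)

lemma top_coeff_word:
  "top_coeff v N (emb r * prod_list (map letter w)) = r * sc (word_weight v N w)"
  by (simp add: prod_list_letters top_coeff_single mult_single)

end

section \<open>Quantum matrices\<close>

definition index_pairs :: "nat \<Rightarrow> (nat \<times> nat) set" where
  "index_pairs N = {(k, l). 1 \<le> k \<and> k < l \<and> l \<le> N}"

lemma finite_index_pairs [simp]: "finite (index_pairs N)"
  by (rule finite_subset[of _ "{1..N} \<times> {1..N}"]) (auto simp: index_pairs_def)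

text \<open>Used to collect letters to the right of their coefficients; the order inside each family
  is kept.\<close>

lemma prod_list_map_mult:
  fixes u y :: "'i \<Rightarrow> 'a::monoid_mult"
  assumes "\<And>i j. y j * u i = u i * y j"
  shows "prod_list (map (\<lambda>i. u i * y i) is) = prod_list (map u is) * prod_list (map y is)"
proof (induction "is")
  case (Cons i "is")
  have "y i * prod_list (map u is) = prod_list (map u is) * y i"
    by (rule prod_list_commute) (use assms in auto)
  then have "y i * (prod_list (map u is) * r) = prod_list (map u is) * (y i * r)" for r
    by (metis mult.assoc)
  then show ?case by (simp add: Cons mult.assoc)
qed simp

lemma prod_list_linear_forms:
  fixes a :: "nat \<Rightarrow> nat \<Rightarrow> 'a::ring_1"
  assumes "\<And>i j k. x k * a i j = a i j * x k"
  shows "prod_list (map (\<lambda>i. \<Sum>k = 1..N. a i k * x k) is) =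
    (\<Sum>w | set w \<subseteq> {1..N} \<and> length w = length is.
       prod_list (map2 a is w) * prod_list (map x w))"
  unfolding prod_list_sum[OF finite_atLeastAtMost]
proof (rule sum.cong[OF refl], clarify)
  fix w :: "nat list"
  assume len: "length w = length is"
  have "prod_list (map (\<lambda>z. a (fst z) (snd z) * x (snd z)) (zip is w)) =
      prod_list (map (\<lambda>z. a (fst z) (snd z)) (zip is w)) * prod_list (map (\<lambda>z. x (snd z)) (zip is w))"
    by (rule prod_list_map_mult) (rule assms)
  also have "map (\<lambda>z. x (snd z)) (zip is w) = map x w"
    using len by (induction w "is" rule: list_induct2) simp_all
  finally show "prod_list (map2 (\<lambda>i k. a i k * x k) is w) =
      prod_list (map2 a is w) * prod_list (map x w)"
    by (simp only: case_prod_unfold)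
qed

context scalar_ideal
begin

text \<open>
  The parameter \<open>p\<close> stands for \<open>r = p\<close>, \<open>s = - 1 / p\<close>; with this normalisation transposition
  amounts to \<open>p \<mapsto> - p\<close>.
\<close>

definition qmatrix :: "complex \<Rightarrow> nat \<Rightarrow> (nat \<Rightarrow> nat \<Rightarrow> 'a) \<Rightarrow> bool" where
  "qmatrix p N a \<longleftrightarrow>
     (\<forall>i\<in>{1..N}. \<forall>k\<in>{1..N}. \<forall>l\<in>{1..N}. k < l \<longrightarrow> a i k * a i l \<approx> sc p * (a i l * a i k)) \<and>
     (\<forall>i\<in>{1..N}. \<forall>j\<in>{1..N}. \<forall>k\<in>{1..N}. i < j \<longrightarrow> a i k * a j k \<approx> sc (- p) * (a j k * a i k)) \<and>
     (\<forall>i\<in>{1..N}. \<forall>j\<in>{1..N}. \<forall>k\<in>{1..N}. \<forall>l\<in>{1..N}. i < j \<longrightarrow> k < l \<longrightarrow>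
        a j k * a i l \<approx> - (a i l * a j k) \<and>
        a j l * a i k \<approx> a i k * a j l - sc (p + inverse p) * (a i l * a j k))"

lemma qmatrix_row:
  "\<lbrakk>qmatrix p N a; i \<in> {1..N}; k \<in> {1..N}; l \<in> {1..N}; k < l\<rbrakk> \<Longrightarrow>
    a i k * a i l \<approx> sc p * (a i l * a i k)"
  by (simp add: qmatrix_def)

lemma qmatrix_cross:
  "\<lbrakk>qmatrix p N a; i \<in> {1..N}; j \<in> {1..N}; k \<in> {1..N}; l \<in> {1..N}; i < j; k < l\<rbrakk> \<Longrightarrow>
    a j k * a i l \<approx> - (a i l * a j k)"
  by (simp add: qmatrix_def)

lemma qmatrix_diag:
  "\<lbrakk>qmatrix p N a; i \<in> {1..N}; j \<in> {1..N}; k \<in> {1..N}; l \<in> {1..N}; i < j; k < l\<rbrakk> \<Longrightarrow>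
    a j l * a i k \<approx> a i k * a j l - sc (p + inverse p) * (a i l * a j k)"
  by (simp add: qmatrix_def)

text \<open>Transposition exchanges the row factor \<open>p\<close> with the column factor
  \<open>- p\<close>. In the last relation it reverses the product of the two anti-diagonal entries;
  these anticommute, so p + 1/p changes sign, as it does when p is replaced by - p.\<close>

lemma qmatrix_transpose:
  assumes "qmatrix p N a"
  shows "qmatrix (- p) N (\<lambda>i j. a j i)"
proof -
  have 1: "a k j * a l i \<approx> - (a l i * a k j)"
    if "i \<in> {1..N}" "j \<in> {1..N}" "k \<in> {1..N}" "l \<in> {1..N}" "i < j" "k < l" for i j k l
    using qmatrix_cross[OF assms, of k l i j] that eqv_minus eqv_sym by fastforce
  have 2: "a l j * a k i \<approx> a k i * a l j - sc (- p + inverse (- p)) * (a l i * a k j)"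
    if *: "i \<in> {1..N}" "j \<in> {1..N}" "k \<in> {1..N}" "l \<in> {1..N}" "i < j" "k < l" for i j k l
  proof -
    have "a l j * a k i \<approx> a k i * a l j - sc (p + inverse p) * (a k j * a l i)"
      by (rule qmatrix_diag[OF assms]) (use * in auto)
    also have "\<dots> \<approx> a k i * a l j - sc (p + inverse p) * (- (a l i * a k j))"
      by (intro eqv_diff eqv_refl eqv_lmult 1 *)
    also have "\<dots> = a k i * a l j - sc (- (p + inverse p)) * (a l i * a k j)"
      by (simp only: sc_minus) simp
    finally show ?thesis by simp
  qed
  show ?thesis
    using 1 2 assms unfolding qmatrix_def by simp
qed

end

section \<open>Linear forms in quasi-commuting letters\<close>

locale linear_forms = scalar_ideal sc I for sc :: "complex \<Rightarrow> 'a::ring_1" and I +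
  fixes p :: complex and N :: nat and a :: "nat \<Rightarrow> nat \<Rightarrow> 'a" and x :: "nat \<Rightarrow> 'a"
  assumes p_nonzero: "p \<noteq> 0"
    and qmatrix: "qmatrix p N a"
    and x_comm: "x k * a i j = a i j * x k"
    and x_swap: "i < j \<Longrightarrow> x j * x i \<approx> sc (- p) * (x i * x j)"
    and x_square: "x i * x i \<approx> 0"
begin

definition \<delta> :: "nat \<Rightarrow> 'a" where
  "\<delta> i = (\<Sum>k = 1..N. a i k * x k)"

text \<open>Terms with k = l vanish and those with k > l fold onto k < l with factor - p.
  Congruences between quadratic forms can then be proved coefficient by coefficient over
  \<open>index_pairs\<close>.\<close>

lemma quadratic_form:
  "(\<Sum>k = 1..N. \<Sum>l = 1..N. c k l * (x k * x l)) \<approx>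
     (\<Sum>(k, l)\<in>index_pairs N. (c k l - sc p * c l k) * (x k * x l))"
proof -
  let ?f = "\<lambda>(k, l). c k l * (x k * x l)"
  let ?D = "(\<lambda>k. (k, k)) ` {1..N}" and ?P = "index_pairs N"
  have "{1..N} \<times> {1..N} = ?D \<union> (?P \<union> prod.swap ` ?P)"
    by (auto simp: index_pairs_def image_iff)
  moreover have "?D \<inter> (?P \<union> prod.swap ` ?P) = {}" "?P \<inter> prod.swap ` ?P = {}"
    by (auto simp: index_pairs_def)
  ultimately have "(\<Sum>k = 1..N. \<Sum>l = 1..N. c k l * (x k * x l)) =
      sum ?f ?D + (sum ?f ?P + sum ?f (prod.swap ` ?P))"
    by (simp add: sum.cartesian_product sum.union_disjoint)
  moreover have "sum ?f ?D \<approx> 0"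
  proof -
    have "sum ?f ?D = (\<Sum>k = 1..N. c k k * (x k * x k))"
      by (subst sum.reindex) (auto simp: inj_on_def)
    moreover have "\<dots> \<approx> (\<Sum>k = 1..N. c k k * 0)"
      by (rule eqv_sum, rule eqv_lmult, rule x_square)
    ultimately show ?thesis by simp
  qed
  moreover have "sum ?f (prod.swap ` ?P) \<approx> (\<Sum>(k, l)\<in>?P. - (sc p * c l k * (x k * x l)))"
  proof -
    have "sum ?f (prod.swap ` ?P) = (\<Sum>(k, l)\<in>?P. c l k * (x l * x k))"
      by (subst sum.reindex) (auto simp: case_prod_unfold)
    moreover have "\<dots> \<approx> (\<Sum>(k, l)\<in>?P. c l k * (sc (- p) * (x k * x l)))"
      unfolding case_prod_unfold
      by (rule eqv_sum, rule eqv_lmult, rule x_swap) (auto simp: index_pairs_def)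
    moreover have "c l k * (sc (- p) * (x k * x l)) = - (sc p * c l k * (x k * x l))" for k l
      by (simp add: sc_minus sc_comm[of p "c l k"] mult.assoc)
    ultimately show ?thesis by simp
  qed
  ultimately have "(\<Sum>k = 1..N. \<Sum>l = 1..N. c k l * (x k * x l)) \<approx>
      0 + (sum ?f ?P + (\<Sum>(k, l)\<in>?P. - (sc p * c l k * (x k * x l))))"
    by (simp only: eqv_add eqv_refl)
  then show ?thesis
    by (simp add: case_prod_unfold left_diff_distrib sum_subtractf sum_negf)
qed

lemma \<delta>_mult: "\<delta> i * \<delta> j = (\<Sum>k = 1..N. \<Sum>l = 1..N. (a i k * a j l) * (x k * x l))"
proof -
  have "(a i k * x k) * (a j l * x l) = (a i k * a j l) * (x k * x l)" for k l
    by (metis x_comm mult.assoc)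
  then show ?thesis
    by (simp add: \<delta>_def sum_product)
qed

lemma \<delta>_square:
  assumes "i \<in> {1..N}"
  shows "\<delta> i * \<delta> i \<approx> 0"
proof -
  have "\<delta> i * \<delta> i \<approx> (\<Sum>(k, l)\<in>index_pairs N. (a i k * a i l - sc p * (a i l * a i k)) * (x k * x l))"
    unfolding \<delta>_mult by (rule quadratic_form)
  also have "\<dots> \<approx> (\<Sum>(k, l)\<in>index_pairs N. 0 * (x k * x l))"
  proof (unfold case_prod_unfold, intro eqv_sum eqv_rmult)
    fix s assume "s \<in> index_pairs N"
    then have "a i (fst s) * a i (snd s) \<approx> sc p * (a i (snd s) * a i (fst s))"
      by (intro qmatrix_row[OF qmatrix]) (use assms in \<open>auto simp: index_pairs_def\<close>)
    then show "a i (fst s) * a i (snd s) - sc p * (a i (snd s) * a i (fst s)) \<approx> 0"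
      by (simp add: eqv_def)
  qed
  finally show ?thesis by (simp add: case_prod_unfold)
qed

text \<open>The coefficient of x_k x_l in the swapped product, rewritten by the cross and diagonal
  relations, is (p (p + 1/p) - 1) a_il a_jk - p a_ik a_jl. Since p (p + 1/p) - 1 = p^2, it is - p
  times the coefficient for the original order.\<close>

lemma \<delta>_swap:
  assumes "i \<in> {1..N}" "j \<in> {1..N}" "i < j"
  shows "\<delta> j * \<delta> i \<approx> sc (- p) * (\<delta> i * \<delta> j)"
proof -
  let ?P = "index_pairs N"
  have "\<delta> j * \<delta> i \<approx> (\<Sum>(k, l)\<in>?P. (a j k * a i l - sc p * (a j l * a i k)) * (x k * x l))"
    unfolding \<delta>_mult by (rule quadratic_form)
  also have "\<dots> \<approx> (\<Sum>(k, l)\<in>?P. (sc (- p) * (a i k * a j l - sc p * (a i l * a j k))) * (x k * x l))"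
  proof (unfold case_prod_unfold, intro eqv_sum eqv_rmult)
    fix s assume s: "s \<in> ?P"
    obtain k l where [simp]: "s = (k, l)" by force
    have "a j k * a i l - sc p * (a j l * a i k) \<approx>
        - (a i l * a j k) - sc p * (a i k * a j l - sc (p + inverse p) * (a i l * a j k))"
      by (intro eqv_diff eqv_lmult qmatrix_cross[OF qmatrix] qmatrix_diag[OF qmatrix])
         (use s assms in \<open>auto simp: index_pairs_def\<close>)
    also have "\<dots> = (sc (p * (p + inverse p)) - 1) * (a i l * a j k) - sc p * (a i k * a j l)"
      by (simp only: sc_mult) (simp add: algebra_simps)
    also have "p * (p + inverse p) = p * p + 1"
      using p_nonzero by (simp add: field_simps)
    also have "(sc (p * p + 1) - 1) * (a i l * a j k) - sc p * (a i k * a j l) =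
        sc (- p) * (a i k * a j l - sc p * (a i l * a j k))"
      by (simp add: sc_add sc_mult sc_minus algebra_simps)
    finally show "a j (fst s) * a i (snd s) - sc p * (a j (snd s) * a i (fst s)) \<approx>
        sc (- p) * (a i (fst s) * a j (snd s) - sc p * (a i (snd s) * a j (fst s)))"
      by simp
  qed
  also have "\<dots> = sc (- p) * (\<Sum>(k, l)\<in>?P. (a i k * a j l - sc p * (a i l * a j k)) * (x k * x l))"
    by (simp add: sum_distrib_left case_prod_unfold mult.assoc)
  also have "\<dots> \<approx> sc (- p) * (\<delta> i * \<delta> j)"
    unfolding \<delta>_mult by (rule eqv_lmult, rule eqv_sym, rule quadratic_form)
  finally show ?thesis .
qed

end

context scalar_ideal
begin

text \<open>The swap factors of two mutually commuting families multiply. This is how row forms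
  paired with the y and column forms paired with the x come to share the base - p^2.\<close>

lemma q_multinomial_product:
  assumes u_swap: "\<And>i j. 1 \<le> i \<Longrightarrow> i < j \<Longrightarrow> j \<le> N \<Longrightarrow> u j * u i \<approx> sc s * (u i * u j)"
    and u_square: "\<And>i. 1 \<le> i \<Longrightarrow> i \<le> N \<Longrightarrow> u i * u i \<approx> 0"
    and y_swap: "\<And>i j. 1 \<le> i \<Longrightarrow> i < j \<Longrightarrow> j \<le> N \<Longrightarrow> y j * y i \<approx> sc t * (y i * y j)"
    and comm: "\<And>i j. y j * u i = u i * y j"
  shows "(\<Sum>i = 1..N. u i * y i) ^ N \<approx> sc (q_factorial (s * t) N) *
    (prod_list (map u [1..<N + 1]) * prod_list (map y [1..<N + 1]))"
proof -
  have mult: "(u i * y i) * (u j * y j) = (u i * u j) * (y i * y j)" for i j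
    by (metis comm mult.assoc)
  have "(u j * y j) * (u i * y i) \<approx> sc (s * t) * ((u i * y i) * (u j * y j))"
    if "1 \<le> i" "i < j" "j \<le> N" for i j
  proof -
    have "(u j * u i) * (y j * y i) \<approx> (sc s * (u i * u j)) * (sc t * (y i * y j))"
      by (intro eqv_mult u_swap y_swap that)
    also have "\<dots> = sc (s * t) * ((u i * u j) * (y i * y j))"
      by (metis sc_lcomm sc_mult mult.assoc)
    finally show ?thesis by (simp only: mult)
  qed
  moreover have "(u i * y i) * (u i * y i) \<approx> 0" if "1 \<le> i" "i \<le> N" for i
    using eqv_rmult[OF u_square[OF that], of "y i * y i"] by (simp only: mult mult_zero_left)
  ultimately show ?thesis
    using q_multinomial[of N "\<lambda>i. u i * y i" "s * t"]
    by (simp only: prod_list_map_mult[of y u, OF comm])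
qed

end

section \<open>Words read in pairs of letters and the Pfaffian expansion\<close>

definition flat_pairs :: "('i \<times> 'i) list \<Rightarrow> 'i list" where
  "flat_pairs ps = concat (map (\<lambda>(k, l). [k, l]) ps)"

lemma flat_pairs_Nil [simp]: "flat_pairs [] = []"
  by (simp add: flat_pairs_def)

lemma flat_pairs_Cons [simp]: "flat_pairs (q # ps) = fst q # snd q # flat_pairs ps"
  by (simp add: flat_pairs_def case_prod_unfold)

lemma flat_pairs_append [simp]: "flat_pairs (ps @ qs) = flat_pairs ps @ flat_pairs qs"
  by (simp add: flat_pairs_def)

lemma prod_list_flat_pairs:
  "prod_list (map x (flat_pairs ps)) = prod_list (map (\<lambda>(k, l). x k * x l :: 'a::monoid_mult) ps)"
  by (induction ps) (simp_all add: case_prod_unfold mult.assoc)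

lemma map_upt_pairs:
  "map f [1..<2 * n + 1] = flat_pairs (map (\<lambda>m. (f (2 * m - 1), f (2 * m))) [1..<n + 1])"
  by (induction n) simp_all

lemma prod_list_upt_pairs:
  fixes f :: "nat \<Rightarrow> 'a::monoid_mult"
  shows "prod_list (map f [1..<2 * n + 1]) = prod_list (map (\<lambda>m. f (2 * m - 1) * f (2 * m)) [1..<n + 1])"
  by (induction n) (simp_all add: mult.assoc)

context scalar_ideal
begin

text \<open>The sum runs over permutations in one-line notation, the form in which
  \<open>top_coeff\<close> delivers it; the row determinant with parameter p is the case
  \<open>v = - p\<close>.\<close>

definition det_words :: "complex \<Rightarrow> nat \<Rightarrow> (nat \<Rightarrow> nat \<Rightarrow> 'a) \<Rightarrow> 'a" where
  "det_words v N a =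
     (\<Sum>w\<in>perm_words N. sc (v ^ list_inv w) * prod_list (map2 a [1..<N + 1] w))"

text \<open>The (k, l) entry of A^T J_(-p) A: the lower left entry of the block J_(-p) is p.\<close>

definition pf_entry :: "complex \<Rightarrow> nat \<Rightarrow> (nat \<Rightarrow> nat \<Rightarrow> 'a) \<Rightarrow> nat \<Rightarrow> nat \<Rightarrow> 'a" where
  "pf_entry p n a k l =
     (\<Sum>m = 1..n. a (2 * m - 1) k * a (2 * m) l + sc p * (a (2 * m) k * a (2 * m - 1) l))"

text \<open>Two factors pass two factors, so \<open>v\<close> is picked up four times. This is the
  origin of the fourth power in the normalising factorial.\<close>

lemma eqv_swap_pairs:
  assumes ca: "c * a \<approx> sc v * (a * c)" and cb: "c * b \<approx> sc v * (b * c)"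
    and da: "d * a \<approx> sc v * (a * d)" and db: "d * b \<approx> sc v * (b * d)"
  shows "(c * d) * (a * b) \<approx> sc (v ^ 4) * ((a * b) * (c * d))"
proof -
  have move: "y * (a * b) \<approx> sc (v * v) * ((a * b) * y)"
    if ya: "y * a \<approx> sc v * (a * y)" and yb: "y * b \<approx> sc v * (b * y)" for y
  proof -
    have "y * (a * b) = (y * a) * b" by (simp only: mult.assoc)
    also have "\<dots> \<approx> (sc v * (a * y)) * b" by (rule eqv_rmult[OF ya])
    also have "\<dots> = (sc v * a) * (y * b)" by (simp only: mult.assoc)
    also have "\<dots> \<approx> (sc v * a) * (sc v * (b * y))" by (rule eqv_lmult[OF yb])
    also have "\<dots> = sc (v * v) * ((a * b) * y)" by (metis sc_mult sc_lcomm mult.assoc)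
    finally show ?thesis .
  qed
  have "(c * d) * (a * b) = c * (d * (a * b))" by (simp only: mult.assoc)
  also have "\<dots> \<approx> c * (sc (v * v) * ((a * b) * d))" by (rule eqv_lmult[OF move[OF da db]])
  also have "\<dots> = sc (v * v) * ((c * (a * b)) * d)" by (metis sc_lcomm mult.assoc)
  also have "\<dots> \<approx> sc (v * v) * ((sc (v * v) * ((a * b) * c)) * d)"
    by (intro eqv_lmult eqv_rmult move ca cb)
  also have "\<dots> = sc ((v * v) * (v * v)) * ((a * b) * (c * d))" by (simp only: sc_mult mult.assoc)
  also have "(v * v) * (v * v) = v ^ 4" by (simp add: power4_eq_xxxx mult.assoc)
  finally show ?thesis .
qed

end

context linear_forms
begin

lemma power_sum_\<delta>_pairs:
  assumes N: "N = 2 * n"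
  shows "(\<Sum>m = 1..n. \<delta> (2 * m - 1) * \<delta> (2 * m)) ^ n \<approx>
    sc (q_factorial (p ^ 4) n) * prod_list (map \<delta> [1..<N + 1])"
proof -
  let ?z = "\<lambda>m. \<delta> (2 * m - 1) * \<delta> (2 * m)"
  have "?z j * ?z i \<approx> sc ((- p) ^ 4) * (?z i * ?z j)" if "1 \<le> i" "i < j" "j \<le> n" for i j
    by (rule eqv_swap_pairs; rule \<delta>_swap) (use that N in auto)
  moreover have "?z i * ?z i \<approx> 0" if i: "1 \<le> i" "i \<le> n" for i
  proof -
    have in_range: "2 * i - 1 \<in> {1..N}" "2 * i \<in> {1..N}" "2 * i - 1 < 2 * i"
      using i N by auto
    \<comment> \<open>Swapping the two inner factors brings the two copies of each form
      together.\<close>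
    have "?z i * ?z i = \<delta> (2 * i - 1) * (\<delta> (2 * i) * \<delta> (2 * i - 1)) * \<delta> (2 * i)"
      by (simp only: mult.assoc)
    also have "\<dots> \<approx> \<delta> (2 * i - 1) * (sc (- p) * (\<delta> (2 * i - 1) * \<delta> (2 * i))) * \<delta> (2 * i)"
      by (rule eqv_rmult, rule eqv_lmult, rule \<delta>_swap) (use in_range in auto)
    also have "\<dots> = (\<delta> (2 * i - 1) * sc (- p) * \<delta> (2 * i - 1)) * (\<delta> (2 * i) * \<delta> (2 * i))"
      by (simp only: mult.assoc)
    also have "\<dots> \<approx> (\<delta> (2 * i - 1) * sc (- p) * \<delta> (2 * i - 1)) * 0"
      by (rule eqv_lmult, rule \<delta>_square) (use in_range in auto)
    finally show ?thesis by simp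
  qed
  ultimately have "(\<Sum>m = 1..n. ?z m) ^ n \<approx> sc (q_factorial ((- p) ^ 4) n) * prod_list (map ?z [1..<n + 1])"
    by (rule q_multinomial)
  also have "prod_list (map ?z [1..<n + 1]) = prod_list (map \<delta> [1..<N + 1])"
    by (simp only: N prod_list_upt_pairs)
  finally show ?thesis by simp
qed

text \<open>\<open>quadratic_form\<close> leaves the second term of each coefficient with column
  \<open>l\<close> before column \<open>k\<close>; the cross relation reverses this order, as an
  entry of A^T J A demands.\<close>

lemma sum_\<delta>_pairs:
  assumes N: "N = 2 * n"
  shows "(\<Sum>m = 1..n. \<delta> (2 * m - 1) * \<delta> (2 * m)) \<approx>
    (\<Sum>(k, l)\<in>index_pairs N. pf_entry p n a k l * (x k * x l))"
proof -
  have "\<delta> (2 * m - 1) * \<delta> (2 * m) \<approx>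
      (\<Sum>(k, l)\<in>index_pairs N.
         (a (2 * m - 1) k * a (2 * m) l + sc p * (a (2 * m) k * a (2 * m - 1) l)) * (x k * x l))"
    if m: "m \<in> {1..n}" for m
  proof -
    have "\<delta> (2 * m - 1) * \<delta> (2 * m) \<approx> (\<Sum>(k, l)\<in>index_pairs N.
         (a (2 * m - 1) k * a (2 * m) l - sc p * (a (2 * m - 1) l * a (2 * m) k)) * (x k * x l))"
      unfolding \<delta>_mult by (rule quadratic_form)
    also have "\<dots> \<approx> (\<Sum>(k, l)\<in>index_pairs N.
         (a (2 * m - 1) k * a (2 * m) l - sc p * (- (a (2 * m) k * a (2 * m - 1) l))) * (x k * x l))"
    proof (unfold case_prod_unfold, rule eqv_sum, rule eqv_rmult, rule eqv_diff[OF eqv_refl], rule eqv_lmult)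
      fix s assume "s \<in> index_pairs N"
      then have "a (2 * m) (fst s) * a (2 * m - 1) (snd s) \<approx> - (a (2 * m - 1) (snd s) * a (2 * m) (fst s))"
        by (intro qmatrix_cross[OF qmatrix]) (use m N in \<open>auto simp: index_pairs_def\<close>)
      then show "a (2 * m - 1) (snd s) * a (2 * m) (fst s) \<approx> - (a (2 * m) (fst s) * a (2 * m - 1) (snd s))"
        using eqv_minus eqv_sym by fastforce
    qed
    finally show ?thesis by simp
  qed
  then have "(\<Sum>m = 1..n. \<delta> (2 * m - 1) * \<delta> (2 * m)) \<approx> (\<Sum>m = 1..n. \<Sum>(k, l)\<in>index_pairs N.
      (a (2 * m - 1) k * a (2 * m) l + sc p * (a (2 * m) k * a (2 * m - 1) l)) * (x k * x l))"
    by (rule eqv_sum)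
  also have "\<dots> = (\<Sum>(k, l)\<in>index_pairs N. pf_entry p n a k l * (x k * x l))"
    by (subst sum.swap) (simp add: pf_entry_def case_prod_unfold sum_distrib_right)
  finally show ?thesis .
qed

lemma x_comm_pf_entry: "x i * pf_entry p n a k l = pf_entry p n a k l * x i"
proof -
  have "x i * (a j k * a j' l) = (a j k * a j' l) * x i" for j j' k l
    by (metis x_comm mult.assoc)
  moreover from this have "x i * (sc p * (a j k * a j' l)) = sc p * (a j k * a j' l) * x i" for j j' k l
    by (simp add: sc_lcomm mult.assoc)
  ultimately show ?thesis
    by (simp add: pf_entry_def sum_distrib_left sum_distrib_right distrib_left distrib_right)
qed

text \<open>The n-th power of one element is computed in both its presentations. Lists of pairs with
  repeated letters are still present on the right; they disappear when the top coefficient is taken,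
  their weight being 0.\<close>

lemma pfaffian_expansion:
  assumes N: "N = 2 * n"
  shows "sc (q_factorial (p ^ 4) n) * prod_list (map \<delta> [1..<N + 1]) \<approx>
    (\<Sum>ps | set ps \<subseteq> index_pairs N \<and> length ps = n.
       prod_list (map (\<lambda>(k, l). pf_entry p n a k l) ps) * prod_list (map x (flat_pairs ps)))"
proof -
  let ?f = "\<lambda>(k, l). pf_entry p n a k l * (x k * x l)"
  have "sc (q_factorial (p ^ 4) n) * prod_list (map \<delta> [1..<N + 1]) \<approx> (\<Sum>s\<in>index_pairs N. ?f s) ^ n"
    by (rule eqv_trans[OF eqv_sym[OF power_sum_\<delta>_pairs[OF N]] eqv_power[OF sum_\<delta>_pairs[OF N]]])
  also have "\<dots> = (\<Sum>ps | set ps \<subseteq> index_pairs N \<and> length ps = n. prod_list (map ?f ps))"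
    by (rule sum_power_lists) simp
  finally have sum_lists: "sc (q_factorial (p ^ 4) n) * prod_list (map \<delta> [1..<N + 1]) \<approx>
      (\<Sum>ps | set ps \<subseteq> index_pairs N \<and> length ps = n. prod_list (map ?f ps))" .
  have "prod_list (map ?f ps) =
      prod_list (map (\<lambda>(k, l). pf_entry p n a k l) ps) * prod_list (map x (flat_pairs ps))" for ps
  proof -
    have "(x k * x l) * pf_entry p n a k' l' = pf_entry p n a k' l' * (x k * x l)" for k l k' l'
      by (metis x_comm_pf_entry mult.assoc)
    then show ?thesis
      using prod_list_map_mult[of "\<lambda>(k, l). x k * x l" "\<lambda>(k, l). pf_entry p n a k l" ps]
      by (simp add: prod_list_flat_pairs case_prod_unfold)
  qed
  with sum_lists show ?thesis by (simp only:)
qed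

end

context scalar_ideal
begin

interpretation ext: scalar_ideal "\<lambda>c. Poly_Mapping.single 0 (sc c)" "ext_ideal v N" for v N
  by (rule ext_scalar_ideal)

lemma qmatrix_emb:
  assumes "qmatrix p N a"
  shows "ext.qmatrix v N' p N (\<lambda>i j. emb (a i j))"
  using assms
  unfolding qmatrix_def ext.qmatrix_def emb_mult[symmetric] emb_diff[symmetric] emb_uminus[symmetric]
  by (blast intro: emb_eqv)

lemma ext_linear_forms:
  assumes "p \<noteq> 0" "qmatrix p N a"
  shows "linear_forms (\<lambda>c. emb (sc c)) (ext_ideal (- p) N) p N (\<lambda>i j. emb (a i j)) letter"
  by (unfold_locales; (rule assms(1) qmatrix_emb[OF assms(2)] letter_commute letter_square letter_swap)?)

end

section \<open>Top coefficients: determinant, Pfaffian and transposition\<close>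

context scalar_ideal
begin

text \<open>Words that are not permutations have weight 0, which cuts the expansion down to the
  determinant. The factor \<open>emb r\<close> serves the transposition argument, where letters of
  the other family stand to the right of the forms.\<close>

lemma top_coeff_det:
  "top_coeff v N (prod_list (map (\<lambda>i. \<Sum>k = 1..N. emb (a i k) * letter k) [1..<N + 1]) * emb r) =
     det_words v N a * r"
proof -
  let ?W = "{w. set w \<subseteq> {1..N} \<and> length w = N}"
  have "prod_list (map2 (\<lambda>i k. emb (a i k)) is w) = emb (prod_list (map2 a is w))" for "is" w
    by (simp only: emb_prod_list map_map comp_def case_prod_unfold)
  then have "prod_list (map (\<lambda>i. \<Sum>k = 1..N. emb (a i k) * letter k) [1..<N + 1]) =
      (\<Sum>w\<in>?W. emb (prod_list (map2 a [1..<N + 1] w)) * prod_list (map letter w))"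
    by (simp only: prod_list_linear_forms[where a = "\<lambda>i k. emb (a i k)", OF letter_commute] length_upt
        add_diff_cancel_right')
  then have "top_coeff v N (prod_list (map (\<lambda>i. \<Sum>k = 1..N. emb (a i k) * letter k) [1..<N + 1])) =
      (\<Sum>w\<in>?W. prod_list (map2 a [1..<N + 1] w) * sc (word_weight v N w))"
    by (simp only: top_coeff_sum top_coeff_word)
  also have "\<dots> = (\<Sum>w\<in>perm_words N. prod_list (map2 a [1..<N + 1] w) * sc (word_weight v N w))"
    by (rule sum.mono_neutral_right)
       (use length_perm_words[of _ N] in \<open>auto simp: finite_lists_length_eq perm_words_def word_weight_def\<close>)
  also have "\<dots> = det_words v N a"
    unfolding det_words_def by (rule sum.cong) (simp_all add: word_weight_def sc_comm)
  finally show ?thesis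
    by (simp only: top_coeff_scale_right)
qed

text \<open>Taking the top coefficient in \<open>pfaffian_expansion\<close> removes the adjoined
  letters and leaves a congruence in the base ring.\<close>

theorem pfaffian_words:
  assumes "p \<noteq> 0" "qmatrix p (2 * n) a"
  shows "sc (q_factorial (p ^ 4) n) * det_words (- p) (2 * n) a \<approx>
    (\<Sum>ps | set ps \<subseteq> index_pairs (2 * n) \<and> length ps = n.
       sc (word_weight (- p) (2 * n) (flat_pairs ps)) * prod_list (map (\<lambda>(k, l). pf_entry p n a k l) ps))"
proof -
  let ?N = "2 * n" and ?A = "\<lambda>i j. emb (a i j)"
  interpret E: linear_forms "\<lambda>c. emb (sc c)" "ext_ideal (- p) ?N" p ?N ?A letter
    by (rule ext_linear_forms[OF assms])
  have pf: "E.pf_entry p n ?A k l = emb (pf_entry p n a k l)" for k l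
    by (simp add: E.pf_entry_def pf_entry_def emb_sum emb_add emb_mult)
  have "top_coeff (- p) ?N (emb (sc (q_factorial (p ^ 4) n)) * prod_list (map E.\<delta> [1..<?N + 1])) \<approx>
    top_coeff (- p) ?N (\<Sum>ps | set ps \<subseteq> index_pairs ?N \<and> length ps = n.
       prod_list (map (\<lambda>(k, l). E.pf_entry p n ?A k l) ps) * prod_list (map letter (flat_pairs ps)))"
    by (rule top_coeff_eqv, rule E.pfaffian_expansion) simp
  also have "top_coeff (- p) ?N (emb (sc (q_factorial (p ^ 4) n)) * prod_list (map E.\<delta> [1..<?N + 1])) =
      sc (q_factorial (p ^ 4) n) * det_words (- p) ?N a"
    using top_coeff_det[of "- p" ?N a 1]
    by (simp add: top_coeff_scale_left E.\<delta>_def[abs_def] flip: One_nat_def)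
  also have "top_coeff (- p) ?N (\<Sum>ps | set ps \<subseteq> index_pairs ?N \<and> length ps = n.
       prod_list (map (\<lambda>(k, l). E.pf_entry p n ?A k l) ps) * prod_list (map letter (flat_pairs ps))) =
     (\<Sum>ps | set ps \<subseteq> index_pairs ?N \<and> length ps = n.
       sc (word_weight (- p) ?N (flat_pairs ps)) * prod_list (map (\<lambda>(k, l). pf_entry p n a k l) ps))"
  proof -
    have "prod_list (map (\<lambda>(k, l). E.pf_entry p n ?A k l) ps) =
        emb (prod_list (map (\<lambda>(k, l). pf_entry p n a k l) ps))" for ps
      by (simp add: pf emb_prod_list case_prod_unfold comp_def)
    then show ?thesis
      by (simp only: top_coeff_sum top_coeff_word sc_comm)
  qed
  finally show ?thesis .
qed

lemma word_weight_upt: "word_weight v N [1..<N + 1] = 1"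
proof -
  have "list_inv [i..<j] = 0" for i j
  proof (induction "j - i" arbitrary: i)
    case (Suc d)
    then have "[i..<j] = i # [Suc i..<j]" by (simp add: upt_conv_Cons)
    moreover have "filter (\<lambda>y. y < i) [Suc i..<j] = []" by (auto simp: filter_empty_conv)
    ultimately show ?case using Suc by simp
  qed simp
  moreover have "[1..<N + 1] \<in> perm_words N"
    by (auto simp: perm_words_def simp del: upt_Suc)
  ultimately show ?thesis by (simp only: word_weight_def power_0 if_True)
qed

lemma top_coeff_upt: "top_coeff v N (prod_list (map letter [1..<N + 1])) = 1"
  using top_coeff_word[of v N 1 "[1..<N + 1]"]
  by (simp only: word_weight_upt sc_one single_one mult_1_left)

theorem det_words_transpose:
  assumes p: "p \<noteq> 0" "\<forall>k\<ge>1. (- (p * p)) ^ k \<noteq> 1" and a: "qmatrix p N a"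
  shows "det_words (- p) N a \<approx> det_words p N (\<lambda>i j. a j i)"
proof -
  \<comment> \<open>The first layer holds letters x with swap factor - p; the second layer
    \<open>K2\<close>, built over it, holds letters y with swap factor p.\<close>
  define K1 where "K1 = ext_ideal (- p) N"
  interpret R1: scalar_ideal "\<lambda>c. emb (sc c)" K1
    unfolding K1_def by (rule ext_scalar_ideal)
  define K2 where "K2 = R1.ext_ideal p N"
  interpret R2: scalar_ideal "\<lambda>c. R1.emb (emb (sc c))" K2
    unfolding K2_def by (rule R1.ext_scalar_ideal)
  interpret L1: linear_forms "\<lambda>c. emb (sc c)" K1 p N "\<lambda>i j. emb (a i j)" letter
    unfolding K1_def by (rule ext_linear_forms[OF p(1) a])
  \<comment> \<open>The transposed matrix has parameter - p, so its forms call for letters with swap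
    factor -(- p) = p, those of the second layer.\<close>
  have "R1.qmatrix (- p) N (\<lambda>i j. emb (a j i))"
    unfolding K1_def by (rule qmatrix_emb[OF qmatrix_transpose[OF a]])
  from R1.ext_linear_forms[OF _ this]
  interpret L2: linear_forms "\<lambda>c. R1.emb (emb (sc c))" K2 "- p" N
      "\<lambda>i j. R1.emb (emb (a j i))" R1.letter
    using p(1) by (simp add: K2_def)

  let ?C = "sc (q_factorial (- (p * p)) N)"
  let ?is = "[1..<N + 1]"
  let ?x = "prod_list (map letter ?is)"
  have top1: "R1.eqv g h \<Longrightarrow> top_coeff (- p) N g \<approx> top_coeff (- p) N h" for g h
    unfolding K1_def by (rule top_coeff_eqv)
  have top2: "R2.eqv g h \<Longrightarrow> R1.eqv (R1.top_coeff p N g) (R1.top_coeff p N h)" for g h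
    unfolding K2_def by (rule R1.top_coeff_eqv)

  have x_comm: "R1.letter i * R1.emb r = R1.emb r * R1.letter i" for i r
    by (rule R1.letter_commute)
  have emb_x_comm: "R1.emb (letter j) * L2.\<delta> i = L2.\<delta> i * R1.emb (letter j)" for i j
  proof -
    have "R1.emb (letter j) * (R1.emb (emb r) * R1.letter k) =
        (R1.emb (emb r) * R1.letter k) * R1.emb (letter j)" for r k
      by (simp add: mult_single)
    then show ?thesis
      by (simp add: L2.\<delta>_def sum_distrib_left sum_distrib_right)
  qed

  \<comment> \<open>\<open>\<Sum> a i k x k y i\<close> is grouped by rows and by columns; its \<open>N\<close>-th power gives both determinants.\<close>
  define \<Phi> where "\<Phi> = (\<Sum>i = 1..N. R1.emb (L1.\<delta> i) * R1.letter i)"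
  have \<Phi>': "\<Phi> = (\<Sum>k = 1..N. L2.\<delta> k * R1.emb (letter k))"
  proof -
    have "R1.emb (emb r * letter k) * R1.letter i = (R1.emb (emb r) * R1.letter i) * R1.emb (letter k)"
      for r k i
      by (simp add: mult_single)
    then show ?thesis
      unfolding \<Phi>_def L1.\<delta>_def L2.\<delta>_def R1.emb_sum sum_distrib_right
      by (subst sum.swap) simp
  qed

  have 1: "R2.eqv (\<Phi> ^ N) (R1.emb (emb (sc (q_factorial (- p * p) N))) *
      (prod_list (map (\<lambda>i. R1.emb (L1.\<delta> i)) ?is) * prod_list (map R1.letter ?is)))"
    unfolding \<Phi>_def
  proof (rule R2.q_multinomial_product)
    fix i j assume ij: "1 \<le> i" "i < j" "j \<le> N"
    have "R1.eqv (L1.\<delta> j * L1.\<delta> i) (emb (sc (- p)) * (L1.\<delta> i * L1.\<delta> j))"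
      by (rule L1.\<delta>_swap) (use ij in auto)
    from R1.emb_eqv[OF this, of p N]
    show "R2.eqv (R1.emb (L1.\<delta> j) * R1.emb (L1.\<delta> i))
        (R1.emb (emb (sc (- p))) * (R1.emb (L1.\<delta> i) * R1.emb (L1.\<delta> j)))"
      by (simp only: R1.emb_mult K2_def)
    show "R2.eqv (R1.letter j * R1.letter i) (R1.emb (emb (sc p)) * (R1.letter i * R1.letter j))"
      unfolding K2_def by (rule R1.letter_swap[OF ij(2)])
  next
    fix i assume i: "1 \<le> i" "i \<le> N"
    have "R1.eqv (L1.\<delta> i * L1.\<delta> i) 0"
      by (rule L1.\<delta>_square) (use i in auto)
    from R1.emb_eqv[OF this, of p N]
    show "R2.eqv (R1.emb (L1.\<delta> i) * R1.emb (L1.\<delta> i)) 0"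
      by (simp only: R1.emb_mult K2_def single_zero)
  next
    show "R1.letter j * R1.emb (L1.\<delta> i) = R1.emb (L1.\<delta> i) * R1.letter j" for i j
      by (rule x_comm)
  qed

  have 2: "R2.eqv (\<Phi> ^ N) (R1.emb (emb (sc (q_factorial (p * - p) N))) *
      (prod_list (map L2.\<delta> ?is) * prod_list (map (\<lambda>k. R1.emb (letter k)) ?is)))"
    unfolding \<Phi>'
  proof (rule R2.q_multinomial_product)
    fix i j assume ij: "1 \<le> i" "i < j" "j \<le> N"
    have "R2.eqv (L2.\<delta> j * L2.\<delta> i) (R1.emb (emb (sc (- (- p)))) * (L2.\<delta> i * L2.\<delta> j))"
      by (rule L2.\<delta>_swap) (use ij in auto)
    then show "R2.eqv (L2.\<delta> j * L2.\<delta> i) (R1.emb (emb (sc p)) * (L2.\<delta> i * L2.\<delta> j))"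
      by (simp only: minus_minus)
    have "R1.eqv (letter j * letter i) (emb (sc (- p)) * (letter i * letter j))"
      unfolding K1_def by (rule letter_swap[OF ij(2)])
    from R1.emb_eqv[OF this, of p N]
    show "R2.eqv (R1.emb (letter j) * R1.emb (letter i))
        (R1.emb (emb (sc (- p))) * (R1.emb (letter i) * R1.emb (letter j)))"
      by (simp only: R1.emb_mult K2_def)
  next
    show "R2.eqv (L2.\<delta> i * L2.\<delta> i) 0" if "1 \<le> i" "i \<le> N" for i
      by (rule L2.\<delta>_square) (use that in auto)
  next
    show "R1.emb (letter j) * L2.\<delta> i = L2.\<delta> i * R1.emb (letter j)" for i j
      by (rule emb_x_comm)
  qed

  \<comment> \<open>The top coefficient is taken in the y only: the product of row forms survives as
    a polynomial in the x.\<close>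
  have top_rows: "R1.top_coeff p N (R1.emb (emb ?C) *
      (prod_list (map (\<lambda>i. R1.emb (L1.\<delta> i)) ?is) * prod_list (map R1.letter ?is))) =
      emb ?C * prod_list (map L1.\<delta> ?is)"
  proof -
    have "prod_list (map (\<lambda>i. R1.emb (L1.\<delta> i)) ?is) = R1.emb (prod_list (map L1.\<delta> ?is))"
      by (simp only: R1.emb_prod_list map_map comp_def)
    then show ?thesis
      by (simp only: R1.top_coeff_scale_left R1.top_coeff_upt mult_1_right)
  qed

  \<comment> \<open>Here the forms carry the y, so the transposed determinant appears already at
    this layer, with x_1 ... x_N still standing beside it.\<close>
  have top_cols: "R1.top_coeff p N (R1.emb (emb ?C) *
      (prod_list (map L2.\<delta> ?is) * prod_list (map (\<lambda>k. R1.emb (letter k)) ?is))) =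
      emb ?C * (emb (det_words p N (\<lambda>i j. a j i)) * ?x)"
  proof -
    have "prod_list (map (\<lambda>k. R1.emb (letter k)) ?is) = R1.emb ?x"
      by (simp only: R1.emb_prod_list map_map comp_def)
    moreover have "R1.det_words p N (\<lambda>i j. emb (a j i)) = emb (det_words p N (\<lambda>i j. a j i))"
      by (simp only: R1.det_words_def det_words_def emb_sum emb_mult emb_prod_list map_map comp_def
          case_prod_unfold)
    ultimately show ?thesis
      unfolding L2.\<delta>_def[abs_def]
      by (simp only: R1.top_coeff_scale_left R1.top_coeff_det)
  qed

  have "R1.eqv (emb ?C * prod_list (map L1.\<delta> ?is)) (emb ?C * (emb (det_words p N (\<lambda>i j. a j i)) * ?x))"
    using top2[OF R2.eqv_trans[OF R2.eqv_sym[OF 1] 2]]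
    by (simp only: mult_minus_left mult_minus_right top_rows top_cols)
  \<comment> \<open>The top coefficient in the x turns the row forms into the determinant and x_1
    ... x_N into 1.\<close>
  from top1[OF this] have "?C * det_words (- p) N a \<approx> ?C * det_words p N (\<lambda>i j. a j i)"
    using top_coeff_det[of "- p" N a 1] unfolding L1.\<delta>_def[abs_def]
    by (simp only: top_coeff_scale_left top_coeff_upt mult_1_right single_one)
  then show ?thesis
    by (rule eqv_cancel_sc) (rule q_factorial_nonzero[OF p(2)])
qed

end

section \<open>From words to permutations\<close>

text \<open>The left end \<open>m\<close> is free because \<open>list_inv\<close> strips the first
  letter, whose contribution counts the inversions starting at \<open>m\<close>.\<close>

lemma num_inversions_word:
  "list_inv (map \<sigma> [m..<M + 1]) =
     card {(i, j). i \<in> {m..M} \<and> j \<in> {m..M} \<and> i < j \<and> \<sigma> i > (\<sigma> j :: nat)}"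
    (is "_ = card (?S m)")
proof (induction "M + 1 - m" arbitrary: m)
  case 0
  then have "?S m = {}" by auto
  then show ?case using 0 by simp
next
  case (Suc d)
  let ?T = "{j \<in> {Suc m..M}. \<sigma> j < \<sigma> m}"
  have S: "?S m = Pair m ` ?T \<union> ?S (Suc m)"
    using Suc(2) by (auto simp: Suc_le_eq le_less)
  have fin: "finite (?S (Suc m))"
    by (rule finite_subset[of _ "{Suc m..M} \<times> {Suc m..M}"]) auto
  have "card (?S m) = card ?T + card (?S (Suc m))"
    unfolding S by (subst card_Un_disjoint) (use fin in \<open>auto simp: card_image inj_on_def\<close>)
  also have "card ?T = length (filter (\<lambda>y. y < \<sigma> m) (map \<sigma> [Suc m..<M + 1]))"
  proof -
    have "?T = set (filter (\<lambda>j. \<sigma> j < \<sigma> m) [Suc m..<M + 1])" by auto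
    then show ?thesis
      by (simp only: distinct_card distinct_filter distinct_upt filter_map length_map comp_def)
  qed
  also have "card (?S (Suc m)) = list_inv (map \<sigma> [Suc m..<M + 1])"
    using Suc by simp
  also have "length (filter (\<lambda>y. y < \<sigma> m) (map \<sigma> [Suc m..<M + 1])) +
      list_inv (map \<sigma> [Suc m..<M + 1]) = list_inv (map \<sigma> [m..<M + 1])"
    using Suc(2) by (subst (3) upt_conv_Cons) auto
  finally show ?case by simp
qed

lemma num_inversions_eq: "num_inversions N \<sigma> = list_inv (map \<sigma> [1..<N + 1])"
  by (simp only: num_inversions_word num_inversions_def)

lemma bij_betw_perm_words:
  "bij_betw (\<lambda>\<sigma>. map \<sigma> [1..<N + 1]) {\<sigma>. \<sigma> permutes {1..N}} (perm_words N)"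
proof (rule bij_betwI')
  have set_upt: "set [1..<N + 1] = {1..N}" by (auto simp del: upt_Suc)
  fix \<sigma> assume \<sigma>: "\<sigma> \<in> {\<sigma>. \<sigma> permutes {1..N}}"
  then show "map \<sigma> [1..<N + 1] \<in> perm_words N"
    using permutes_inj_on[of \<sigma> "{1..N}" "{1..N}"]
    by (simp only: perm_words_def mem_Collect_eq distinct_map distinct_upt set_map set_upt permutes_image simp_thms)
  fix \<tau> assume \<tau>: "\<tau> \<in> {\<sigma>. \<sigma> permutes {1..N}}"
  show "map \<sigma> [1..<N + 1] = map \<tau> [1..<N + 1] \<longleftrightarrow> \<sigma> = \<tau>"
  proof
    assume "map \<sigma> [1..<N + 1] = map \<tau> [1..<N + 1]"
    then have "\<sigma> i = \<tau> i" if "i \<in> {1..N}" for i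
      using that by (simp only: map_eq_conv set_upt)
    moreover have "\<sigma> i = \<tau> i" if "i \<notin> {1..N}" for i
      using that \<sigma> \<tau> by (simp add: permutes_not_in)
    ultimately show "\<sigma> = \<tau>" by blast
  qed simp
next
  fix w assume w: "w \<in> perm_words N"
  then have len: "length w = N" by (rule length_perm_words)
  \<comment> \<open>List positions start at 0, and \<open>permutes\<close> demands the identity
    outside {1..N}.\<close>
  define \<sigma> where "\<sigma> i = (if i \<in> {1..N} then w ! (i - 1) else i)" for i
  have word: "map \<sigma> [1..<N + 1] = w"
    by (rule nth_equalityI) (auto simp: len \<sigma>_def simp del: upt_Suc)
  have "inj_on \<sigma> {1..N}"
    using w len by (auto simp: inj_on_def \<sigma>_def perm_words_def nth_eq_iff_index_eq)
  moreover have "\<sigma> ` {1..N} = {1..N}"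
  proof -
    have "\<sigma> ` {1..N} = set (map \<sigma> [1..<N + 1])"
      by (simp add: atLeastLessThanSuc_atLeastAtMost del: upt_Suc)
    then show ?thesis using w by (simp only: word perm_words_def mem_Collect_eq)
  qed
  ultimately have "\<sigma> permutes {1..N}"
    by (intro bij_imp_permutes) (auto simp: bij_betw_def \<sigma>_def)
  with word show "\<exists>\<sigma>\<in>{\<sigma>. \<sigma> permutes {1..N}}. w = map \<sigma> [1..<N + 1]"
    by blast
qed

lemma flat_pairs_inject:
  "length ps = length qs \<Longrightarrow> flat_pairs ps = flat_pairs qs \<longleftrightarrow> ps = qs"
  by (induction ps qs rule: list_induct2) (auto simp: prod_eq_iff)

text \<open>Membership in \<open>index_pairs\<close> encodes the ascent within each pair, and the
  condition on \<open>flat_pairs\<close> encodes bijectivity.\<close>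

lemma bij_betw_pair_perms:
  "bij_betw (\<lambda>\<sigma>. map (\<lambda>m. (\<sigma> (2 * m - 1), \<sigma> (2 * m))) [1..<n + 1]) (pair_perms n)
     {ps. set ps \<subseteq> index_pairs (2 * n) \<and> length ps = n \<and> flat_pairs ps \<in> perm_words (2 * n)}"
    (is "bij_betw ?f _ ?P")
proof (rule bij_betwI')
  have flat: "flat_pairs (?f \<sigma>) = map \<sigma> [1..<2 * n + 1]" for \<sigma> :: "nat \<Rightarrow> nat"
    by (rule map_upt_pairs[symmetric])
  fix \<sigma> assume \<sigma>: "\<sigma> \<in> pair_perms n"
  then have perm: "\<sigma> permutes {1..2 * n}" by (simp add: pair_perms_def)
  have "flat_pairs (?f \<sigma>) \<in> perm_words (2 * n)"
    unfolding flat using bij_betw_apply[OF bij_betw_perm_words] perm by blast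
  moreover have "set (?f \<sigma>) \<subseteq> index_pairs (2 * n)"
  proof clarify
    fix k l assume "(k, l) \<in> set (?f \<sigma>)"
    then obtain m where "m \<in> set [1..<n + 1]" and kl: "k = \<sigma> (2 * m - 1)" "l = \<sigma> (2 * m)"
      by (auto simp del: upt_Suc set_upt)
    then have m: "m \<in> {1..n}" by auto
    have "k \<in> {1..2 * n}" "l \<in> {1..2 * n}"
      unfolding kl permutes_in_image[OF perm] using m by auto
    then show "(k, l) \<in> index_pairs (2 * n)"
      using m kl \<sigma> by (auto simp: index_pairs_def pair_perms_def)
  qed
  ultimately show "?f \<sigma> \<in> ?P" by (simp del: upt_Suc)
  fix \<tau> assume \<tau>: "\<tau> \<in> pair_perms n"
  show "?f \<sigma> = ?f \<tau> \<longleftrightarrow> \<sigma> = \<tau>"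
  proof
    assume "?f \<sigma> = ?f \<tau>"
    then have "map \<sigma> [1..<2 * n + 1] = map \<tau> [1..<2 * n + 1]"
      by (simp only: flat[symmetric])
    then show "\<sigma> = \<tau>"
      by (rule inj_onD[OF bij_betw_imp_inj_on[OF bij_betw_perm_words]])
         (use \<sigma> \<tau> in \<open>simp_all add: pair_perms_def\<close>)
  qed simp
next
  fix ps assume ps: "ps \<in> ?P"
  then have "flat_pairs ps \<in> (\<lambda>\<sigma>. map \<sigma> [1..<2 * n + 1]) ` {\<sigma>. \<sigma> permutes {1..2 * n}}"
    by (simp only: bij_betw_imp_surj_on[OF bij_betw_perm_words] mem_Collect_eq)
  then obtain \<sigma> where \<sigma>: "\<sigma> permutes {1..2 * n}" "flat_pairs ps = map \<sigma> [1..<2 * n + 1]"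
    by blast
  have f: "?f \<sigma> = ps"
  proof -
    have "length (?f \<sigma>) = length ps" using ps by (simp del: upt_Suc)
    then show ?thesis
      by (rule iffD1[OF flat_pairs_inject]) (simp only: \<sigma>(2) map_upt_pairs)
  qed
  have "\<sigma> (2 * i - 1) < \<sigma> (2 * i)" if "i \<in> {1..n}" for i
  proof -
    have "(\<sigma> (2 * i - 1), \<sigma> (2 * i)) \<in> set (?f \<sigma>)"
      using that by (auto simp del: upt_Suc)
    then show ?thesis
      unfolding f using ps by (auto simp: index_pairs_def)
  qed
  with \<sigma>(1) f show "\<exists>\<sigma>\<in>pair_perms n. ps = ?f \<sigma>"
    unfolding pair_perms_def by blast
qed

context scalar_ideal
begin

lemma det_words_permutations:
  "det_words v N a = (\<Sum>\<sigma> | \<sigma> permutes {1..N}.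
     sc (v ^ num_inversions N \<sigma>) * prod_list (map (\<lambda>i. a i (\<sigma> i)) [1..<N + 1]))"
proof -
  have "map2 a is (map \<sigma> is) = map (\<lambda>i. a i (\<sigma> i)) is" for \<sigma> and "is" :: "nat list"
    by (induction "is") auto
  then show ?thesis
    unfolding det_words_def num_inversions_eq
    by (subst sum.reindex_bij_betw[OF bij_betw_perm_words, symmetric]) (simp only:)
qed

text \<open>Lists of pairs that do not flatten to a permutation have weight 0 and drop out; the rest
  correspond to \<open>pair_perms\<close>.\<close>

lemma pfaffian_words_permutations:
  "(\<Sum>ps | set ps \<subseteq> index_pairs (2 * n) \<and> length ps = n.
      sc (word_weight v (2 * n) (flat_pairs ps)) * prod_list (map (\<lambda>(k, l). b k l) ps)) =
   (\<Sum>\<sigma>\<in>pair_perms n. sc (v ^ num_inversions (2 * n) \<sigma>) *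
      prod_list (map (\<lambda>i. b (\<sigma> (2 * i - 1)) (\<sigma> (2 * i))) [1..<n + 1]))"
proof -
  let ?P = "{ps. set ps \<subseteq> index_pairs (2 * n) \<and> length ps = n \<and> flat_pairs ps \<in> perm_words (2 * n)}"
  let ?g = "\<lambda>ps. sc (word_weight v (2 * n) (flat_pairs ps)) * prod_list (map (\<lambda>(k, l). b k l) ps)"
  have "(\<Sum>ps | set ps \<subseteq> index_pairs (2 * n) \<and> length ps = n. ?g ps) = sum ?g ?P"
    by (rule sum.mono_neutral_right) (auto simp: finite_lists_length_eq word_weight_def)
  also have "\<dots> = (\<Sum>\<sigma>\<in>pair_perms n. ?g (map (\<lambda>m. (\<sigma> (2 * m - 1), \<sigma> (2 * m))) [1..<n + 1]))"
    by (rule sum.reindex_bij_betw[OF bij_betw_pair_perms, symmetric])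
  also have "\<dots> = (\<Sum>\<sigma>\<in>pair_perms n. sc (v ^ num_inversions (2 * n) \<sigma>) *
      prod_list (map (\<lambda>i. b (\<sigma> (2 * i - 1)) (\<sigma> (2 * i))) [1..<n + 1]))"
  proof (rule sum.cong[OF refl])
    fix \<sigma> assume "\<sigma> \<in> pair_perms n"
    then have "map \<sigma> [1..<2 * n + 1] \<in> perm_words (2 * n)"
      using bij_betw_apply[OF bij_betw_perm_words] by (auto simp: pair_perms_def simp del: upt_Suc)
    then show "?g (map (\<lambda>m. (\<sigma> (2 * m - 1), \<sigma> (2 * m))) [1..<n + 1]) =
        sc (v ^ num_inversions (2 * n) \<sigma>) *
          prod_list (map (\<lambda>i. b (\<sigma> (2 * i - 1)) (\<sigma> (2 * i))) [1..<n + 1])"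
      by (simp only: map_upt_pairs[symmetric] word_weight_def num_inversions_eq if_True map_map comp_def
          case_prod_conv)
  qed
  finally show ?thesis .
qed

end

section \<open>Presented algebras\<close>

abbreviation word_span :: "'x set \<Rightarrow> ('x list \<Rightarrow>\<^sub>0 complex) set" where
  "word_span X \<equiv> {p. \<forall>w \<in> Poly_Mapping.keys p. set w \<subseteq> X}"

lemma fa_scale_eq: "fa_scale c p = Poly_Mapping.single 0 c * p"
  by (simp add: fa_scale_def mult_map_scale_conv_mult)

lemma word_span_zero: "0 \<in> word_span X"
  by simp

lemma word_span_single: "set w \<subseteq> X \<Longrightarrow> Poly_Mapping.single w c \<in> word_span X"
  by simp

lemma word_span_add: "p \<in> word_span X \<Longrightarrow> r \<in> word_span X \<Longrightarrow> p + r \<in> word_span X"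
  using keys_add[of p r] by blast

lemma word_span_mult: "p \<in> word_span X \<Longrightarrow> r \<in> word_span X \<Longrightarrow> p * r \<in> word_span X"
  using keys_mult[of p r] by (fastforce simp: plus_list_def)

lemma word_span_one: "1 \<in> word_span X"
  by (simp add: zero_list_def)

lemma word_span_uminus: "p \<in> word_span X \<Longrightarrow> - p \<in> word_span X"
  by (simp add: in_keys_iff)

lemma word_span_diff: "p \<in> word_span X \<Longrightarrow> r \<in> word_span X \<Longrightarrow> p - r \<in> word_span X"
  using word_span_add[of p X "- r"] word_span_uminus[of r X] by simp

lemma word_span_scale: "p \<in> word_span X \<Longrightarrow> fa_scale c p \<in> word_span X"
  unfolding fa_scale_eq by (rule word_span_mult) (simp_all add: zero_list_def)

lemma word_span_gen: "x \<in> X \<Longrightarrow> fa_gen x \<in> word_span X"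
  by (simp add: fa_gen_def)

lemma free_alg_simps:
  "carrier (free_alg X) = word_span X" "monoid.mult (free_alg X) = (*)" "one (free_alg X) = 1"
  "zero (free_alg X) = 0" "add (free_alg X) = (+)" "smult (free_alg X) = fa_scale"
  by (simp_all add: free_alg_def)

lemma ring_free_alg: "ring (free_alg X)"
proof (rule ringI)
  show "abelian_group (free_alg X)"
  proof (rule abelian_groupI, unfold free_alg_simps)
    show "\<exists>y\<in>word_span X. y + x = 0" if "x \<in> word_span X" for x
      using word_span_uminus[OF that] by (intro bexI[of _ "- x"]) auto
  qed (rule word_span_add word_span_zero; assumption | simp add: algebra_simps)+
  show "monoid (free_alg X)"
    by (rule monoidI, unfold free_alg_simps)
       (rule word_span_mult word_span_one; assumption | simp add: mult.assoc)+
qed (simp_all add: free_alg_simps algebra_simps)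

lemma free_alg_minus:
  assumes "p \<in> word_span X" "r \<in> word_span X"
  shows "p \<ominus>\<^bsub>free_alg X\<^esub> r = p - r"
proof -
  interpret ring "free_alg X" by (rule ring_free_alg)
  have "\<ominus>\<^bsub>free_alg X\<^esub> r = - r"
    by (rule minus_equality) (use assms word_span_uminus[of r X] in \<open>auto simp: free_alg_simps\<close>)
  then show ?thesis by (simp add: a_minus_def free_alg_simps)
qed

locale presented_algebra =
  fixes X :: "'x set" and S :: "('x list \<Rightarrow>\<^sub>0 complex) set"
  assumes relators: "S \<subseteq> word_span X"
begin

definition J :: "('x list \<Rightarrow>\<^sub>0 complex) set" where
  "J = genideal (free_alg X) S"

definition G :: "(complex, ('x list \<Rightarrow>\<^sub>0 complex) set) module" where
  "G = alg_quot (free_alg X) S"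

definition \<pi> :: "('x list \<Rightarrow>\<^sub>0 complex) \<Rightarrow> ('x list \<Rightarrow>\<^sub>0 complex) set" where
  "\<pi> p = J +>\<^bsub>free_alg X\<^esub> p"

sublocale F: ring "free_alg X"
  by (rule ring_free_alg)

sublocale ideal J "free_alg X"
  unfolding J_def by (rule F.genideal_ideal) (use relators in \<open>simp add: free_alg_simps\<close>)

lemma relator_in: "p \<in> S \<Longrightarrow> p \<in> J"
  using F.genideal_self[of S] relators by (auto simp: J_def free_alg_simps)

lemma J_subset: "p \<in> J \<Longrightarrow> p \<in> word_span X"
  using a_Hcarr by (simp add: free_alg_simps)

lemma J_add: "p \<in> J \<Longrightarrow> r \<in> J \<Longrightarrow> p + r \<in> J"
  using a_closed by (simp add: free_alg_simps)

lemma J_mult: "p \<in> J \<Longrightarrow> r \<in> word_span X \<Longrightarrow> r * p \<in> J"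
  using I_l_closed by (simp add: free_alg_simps)

lemma J_mult': "p \<in> J \<Longrightarrow> r \<in> word_span X \<Longrightarrow> p * r \<in> J"
  using I_r_closed by (simp add: free_alg_simps)

text \<open>
  \<^term>\<open>J\<close> is an ideal of the subalgebra \<^term>\<open>word_span X\<close> only.  Adding the span of all words with
  a letter outside \<^term>\<open>X\<close> gives an ideal of the whole type with the same trace on the subalgebra.
\<close>

definition foreign :: "('x list \<Rightarrow>\<^sub>0 complex) set" where
  "foreign = {p. \<forall>w \<in> Poly_Mapping.keys p. \<not> set w \<subseteq> X}"

definition J' :: "('x list \<Rightarrow>\<^sub>0 complex) set" where
  "J' = {p + r | p r. p \<in> J \<and> r \<in> foreign}"

lemma foreign_add: "p \<in> foreign \<Longrightarrow> r \<in> foreign \<Longrightarrow> p + r \<in> foreign"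
  using keys_add[of p r] unfolding foreign_def by blast

lemma foreign_mult: "p \<in> foreign \<Longrightarrow> r * p \<in> foreign"
  using keys_mult[of r p] unfolding foreign_def by (fastforce simp: plus_list_def)

lemma foreign_mult': "p \<in> foreign \<Longrightarrow> p * r \<in> foreign"
  using keys_mult[of p r] unfolding foreign_def by (fastforce simp: plus_list_def)

lemma foreign_zero: "0 \<in> foreign"
  by (simp add: foreign_def)

lemma J_zero: "0 \<in> J"
  using zero_closed by (simp add: free_alg_simps)

lemma J'_add: "x \<in> J' \<Longrightarrow> y \<in> J' \<Longrightarrow> x + y \<in> J'"
proof -
  assume "x \<in> J'" "y \<in> J'"
  then obtain p r p' r' where "x = p + r" "y = p' + r'" "p \<in> J" "p' \<in> J" "r \<in> foreign" "r' \<in> foreign"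
    unfolding J'_def by blast
  then show ?thesis
    unfolding J'_def by (intro CollectI exI[of _ "p + p'"] exI[of _ "r + r'"])
      (simp add: J_add foreign_add algebra_simps)
qed

lemma foreign_in_J': "p \<in> foreign \<Longrightarrow> p \<in> J'"
  unfolding J'_def using J_zero by force

lemma J_in_J': "p \<in> J \<Longrightarrow> p \<in> J'"
  unfolding J'_def using foreign_zero by force

text \<open>The foreign part of a polynomial over \<open>X\<close> is a difference of two
  polynomials over \<open>X\<close>, so it contains no word at all.\<close>

lemma J'_in_J:
  assumes "x \<in> J'" "x \<in> word_span X"
  shows "x \<in> J"
proof -
  obtain p r where x: "x = p + r" "p \<in> J" "r \<in> foreign"
    using assms(1) unfolding J'_def by blast
  then have "r \<in> word_span X"
    using word_span_diff[OF assms(2) J_subset[OF x(2)]] by simp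
  with x(3) have "Poly_Mapping.keys r = {}"
    unfolding foreign_def by blast
  then have "r = 0"
    by (intro poly_mapping_eqI) (auto simp: in_keys_iff)
  with x show ?thesis by simp
qed

text \<open>It suffices to multiply by a single term. A word over \<open>X\<close> keeps both
  summands in place, and any other word makes the whole product foreign.\<close>

lemma J'_mult:
  assumes "x \<in> J'"
  shows "y * x \<in> J'" "x * y \<in> J'"
proof -
  obtain p r where x: "x = p + r" "p \<in> J" "r \<in> foreign"
    using assms unfolding J'_def by blast
  have f: "Poly_Mapping.single w c \<in> foreign" if "\<not> set w \<subseteq> X" for w c
    using that by (simp add: foreign_def)
  show "y * x \<in> J'"
  proof (induction y rule: poly_mapping_sum_induct)
    case (single w c)
    show ?case
    proof (cases "set w \<subseteq> X")
      case True
      then show ?thesis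
        unfolding x distrib_left
        by (intro J'_add J_in_J' J_mult foreign_in_J' foreign_mult x(2,3) word_span_single)
    next
      case False
      then show ?thesis by (intro foreign_in_J' foreign_mult' f)
    qed
  qed (simp_all add: J'_add distrib_right foreign_in_J'[OF foreign_zero])
  show "x * y \<in> J'"
  proof (induction y rule: poly_mapping_sum_induct)
    case (single w c)
    show ?case
    proof (cases "set w \<subseteq> X")
      case True
      then show ?thesis
        unfolding x distrib_right
        by (intro J'_add J_in_J' J_mult' foreign_in_J' foreign_mult' x(2,3) word_span_single)
    next
      case False
      then show ?thesis by (intro foreign_in_J' foreign_mult f)
    qed
  qed (simp_all add: J'_add distrib_left foreign_in_J'[OF foreign_zero])
qed

lemma scalar_ideal_J': "scalar_ideal (Poly_Mapping.single 0) J'"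
proof
  fix c :: complex and x :: "'x list \<Rightarrow>\<^sub>0 complex"
  show "Poly_Mapping.single 0 c * x = x * Poly_Mapping.single 0 c"
    by (induction x rule: poly_mapping_sum_induct) (simp_all add: mult_single algebra_simps)
qed (simp_all add: single_add mult_single J'_add J'_mult foreign_in_J'[OF foreign_zero])

lemma quotient_simps:
  "carrier G = carrier (free_alg X Quot J)" "monoid.mult G = monoid.mult (free_alg X Quot J)"
  "one G = one (free_alg X Quot J)" "zero G = zero (free_alg X Quot J)"
  "add G = add (free_alg X Quot J)"
  by (simp_all add: G_def alg_quot_def Let_def ring.defs J_def)

sublocale Q: abelian_monoid G
proof -
  interpret R: ring "free_alg X Quot J" by (rule quotient_is_ring)
  show "abelian_monoid G"
    by (rule abelian_monoidI; unfold quotient_simps)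
       (rule R.a_closed R.zero_closed R.a_assoc R.l_zero R.a_comm; assumption)+
qed

section \<open>Polynomial representatives for elements of the quotient\<close>

lemma \<pi>_eq_iff:
  "p \<in> word_span X \<Longrightarrow> r \<in> word_span X \<Longrightarrow> \<pi> p = \<pi> r \<longleftrightarrow> p - r \<in> J"
  using F.quotient_eq_iff_same_a_r_cos[OF ideal_axioms, of p r]
  by (simp add: \<pi>_def free_alg_simps free_alg_minus)

text \<open>A bridge between two styles: each operation of the record \<open>G\<close> is shadowed
  by the type-class operation on polynomials, so an identity in \<open>G\<close> reduces to a
  congruence modulo \<open>J'\<close>.\<close>

definition represents :: "('x list \<Rightarrow>\<^sub>0 complex) set \<Rightarrow> ('x list \<Rightarrow>\<^sub>0 complex) \<Rightarrow> bool" where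
  "represents g p \<longleftrightarrow> p \<in> word_span X \<and> g = \<pi> p"

lemma represents_gen: "x \<in> X \<Longrightarrow> represents (\<pi> (fa_gen x)) (fa_gen x)"
  by (simp only: represents_def word_span_gen simp_thms)

lemma represents_closed: "represents g p \<Longrightarrow> g \<in> carrier G"
  using ring_hom_closed[OF rcos_ring_hom]
  by (simp add: represents_def quotient_simps \<pi>_def free_alg_simps)

lemma represents_one: "represents \<one>\<^bsub>G\<^esub> 1"
  using ring_hom_one[OF rcos_ring_hom] word_span_one[of X]
  by (simp add: represents_def quotient_simps \<pi>_def free_alg_simps)

lemma represents_zero: "represents \<zero>\<^bsub>G\<^esub> 0"
  using F.a_rcos_zero[OF ideal_axioms J_zero]
  by (simp add: represents_def quotient_simps \<pi>_def FactRing_def)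

lemma represents_mult:
  "represents g p \<Longrightarrow> represents h r \<Longrightarrow> represents (g \<otimes>\<^bsub>G\<^esub> h) (p * r)"
  using ring_hom_mult[OF rcos_ring_hom, of p r] word_span_mult[of p X r]
  by (simp add: represents_def quotient_simps \<pi>_def free_alg_simps)

lemma represents_add:
  "represents g p \<Longrightarrow> represents h r \<Longrightarrow> represents (g \<oplus>\<^bsub>G\<^esub> h) (p + r)"
  using ring_hom_add[OF rcos_ring_hom, of p r] word_span_add[of p X r]
  by (simp add: represents_def quotient_simps \<pi>_def free_alg_simps)

text \<open>\<open>alg_quot\<close> defines the action as a union over representatives. By the ideal
  property every member of the coset contributes the same coset, and \<open>p\<close> itself is one
  of them.\<close>

lemma represents_smult:
  assumes "represents g p"
  shows "represents (c \<odot>\<^bsub>G\<^esub> g) (Poly_Mapping.single 0 c * p)"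
proof -
  have p: "p \<in> word_span X" and g: "g = \<pi> p"
    using assms by (simp_all add: represents_def)
  have self: "p \<in> \<pi> p"
    using a_rcos_self p by (simp add: \<pi>_def free_alg_simps)
  have "\<pi> (fa_scale c y) = \<pi> (fa_scale c p)" if y: "y \<in> \<pi> p" for y
  proof -
    have yX: "y \<in> word_span X"
      using a_elemrcos_carrier[of p y] y p by (simp add: \<pi>_def free_alg_simps)
    have "\<pi> p = \<pi> y"
      using a_repr_independence'[of y p] y p by (simp add: \<pi>_def free_alg_simps)
    then have "y - p \<in> J"
      using \<pi>_eq_iff[OF yX p] by simp
    then have "Poly_Mapping.single 0 c * (y - p) \<in> J"
      by (rule J_mult) (simp add: zero_list_def)
    then have "fa_scale c y - fa_scale c p \<in> J"
      by (simp only: fa_scale_eq right_diff_distrib)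
    then show ?thesis
      by (simp only: \<pi>_eq_iff[OF word_span_scale[OF yX] word_span_scale[OF p]])
  qed
  then have "(\<Union>y\<in>\<pi> p. \<pi> (fa_scale c y)) = \<pi> (fa_scale c p)"
    using self by blast
  moreover have "c \<odot>\<^bsub>G\<^esub> g = (\<Union>y\<in>g. \<pi> (fa_scale c y))"
    by (simp add: G_def alg_quot_def Let_def ring.defs module.defs \<pi>_def J_def free_alg_simps)
  ultimately show ?thesis
    unfolding represents_def g fa_scale_eq[symmetric] using word_span_scale[OF p] by simp
qed

lemma represents_finsum:
  "(\<And>i. i \<in> A \<Longrightarrow> represents (g i) (f i)) \<Longrightarrow> represents (finsum G g A) (sum f A)"
proof (induction A rule: infinite_finite_induct)
  case (insert x A)
  then have "finsum G g (insert x A) = g x \<oplus>\<^bsub>G\<^esub> finsum G g A"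
    by (intro Q.finsum_insert) (auto intro: represents_closed)
  then show ?case
    using insert by (simp add: represents_add)
qed (simp_all add: Q.finsum_infinite represents_zero)

lemma represents_ordered_prod:
  "(\<And>i. i \<in> set is \<Longrightarrow> represents (g i) (f i)) \<Longrightarrow>
    represents (ordered_prod G (map g is)) (prod_list (map f is))"
  unfolding ordered_prod_def by (induction "is") (simp_all add: represents_one represents_mult)

end

context presented_algebra
begin

lemma represents_rdet:
  assumes "\<And>i j. i \<in> {1..N} \<Longrightarrow> j \<in> {1..N} \<Longrightarrow> represents (A i j) (a i j)"
  shows "represents (rdet q G N A) (\<Sum>\<sigma> | \<sigma> permutes {1..N}.
    Poly_Mapping.single 0 ((- q) ^ num_inversions N \<sigma>) * prod_list (map (\<lambda>i. a i (\<sigma> i)) [1..<N + 1]))"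
  unfolding rdet_def
proof (intro represents_finsum represents_smult represents_ordered_prod assms)
  fix \<sigma> i assume "\<sigma> \<in> {\<sigma>. \<sigma> permutes {1..N}}" and "i \<in> set [1..<N + 1]"
  then have "\<sigma> permutes {1..N}" and i: "i \<in> {1..N}" by auto
  then show "i \<in> {1..N}" "\<sigma> i \<in> {1..N}"
    by (simp_all only: permutes_in_image)
qed

lemma represents_pfaffian_sum:
  assumes "\<And>i j. i \<in> {1..2 * n} \<Longrightarrow> j \<in> {1..2 * n} \<Longrightarrow> represents (B i j) (b i j)"
  shows "represents
    (c \<odot>\<^bsub>G\<^esub> (\<Oplus>\<^bsub>G\<^esub>\<sigma>\<in>pair_perms n. u ^ num_inversions (2 * n) \<sigma> \<odot>\<^bsub>G\<^esub>
       ordered_prod G (map (\<lambda>i. B (\<sigma> (2 * i - 1)) (\<sigma> (2 * i))) [1..<n + 1])))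
    (Poly_Mapping.single 0 c * (\<Sum>\<sigma>\<in>pair_perms n.
       Poly_Mapping.single 0 (u ^ num_inversions (2 * n) \<sigma>) *
         prod_list (map (\<lambda>i. b (\<sigma> (2 * i - 1)) (\<sigma> (2 * i))) [1..<n + 1])))"
proof (intro represents_smult represents_finsum represents_ordered_prod assms)
  fix \<sigma> i assume "\<sigma> \<in> pair_perms n" and "i \<in> set [1..<n + 1]"
  then have "\<sigma> permutes {1..2 * n}" and i: "2 * i - 1 \<in> {1..2 * n}" "2 * i \<in> {1..2 * n}"
    by (auto simp: pair_perms_def)
  then show "\<sigma> (2 * i - 1) \<in> {1..2 * n}" "\<sigma> (2 * i) \<in> {1..2 * n}"
    by (simp_all only: permutes_in_image)
qed

text \<open>Congruence is meant in the sense of A^T V A. The polynomial keeps the shape left by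
  \<open>scalar_mat\<close>, a scalar times 1, to match \<open>pf_entry_J_mat\<close>.\<close>

lemma represents_congruence:
  assumes A: "\<And>i j. i \<in> {1..N} \<Longrightarrow> j \<in> {1..N} \<Longrightarrow> represents (A i j) (a i j)"
    and "i \<in> {1..N}" "j \<in> {1..N}"
  shows "represents (mat_mult G N (mat_mult G N (mat_transpose A) (scalar_mat G V)) A i j)
    (\<Sum>k = 1..N. (\<Sum>l = 1..N. a l i * (Poly_Mapping.single 0 (V l k) * 1)) * a k j)"
  unfolding mat_mult_def mat_transpose_def scalar_mat_def
  by (intro represents_finsum represents_mult represents_smult represents_one A assms(2,3))

text \<open>Both representatives lie over \<open>X\<close>, so their congruence modulo the enlarged
  ideal already holds modulo \<open>J\<close>.\<close>

lemma represents_eq: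
  assumes "represents g p" "represents h r" "scalar_ideal.eqv J' p r"
  shows "g = h"
proof -
  interpret scalar_ideal "Poly_Mapping.single 0" J'
    by (rule scalar_ideal_J')
  have "p - r \<in> J'"
    using assms(3) unfolding eqv_def .
  moreover have pr: "p \<in> word_span X" "r \<in> word_span X"
    using assms(1,2) unfolding represents_def by blast+
  ultimately have "p - r \<in> J"
    by (intro J'_in_J word_span_diff)
  then have "\<pi> p = \<pi> r"
    by (simp only: \<pi>_eq_iff[OF pr])
  then show ?thesis
    using assms(1,2) by (simp only: represents_def)
qed

end

section \<open>The entries of A^T J A and the relations of the quantum group\<close>

lemma sum_pairs:
  fixes f :: "nat \<Rightarrow> 'a::comm_monoid_add"
  shows "(\<Sum>k = 1..2 * n. f k) = (\<Sum>m = 1..n. f (2 * m - 1) + f (2 * m))"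
  by (induction n) (simp_all add: add.assoc)

text \<open>Each column of J_v has one nonzero entry: 1 in row 2m - 1 of column 2m, and - v in row
  2m of column 2m - 1. Hence J_v belongs to the parameter \<open>- v\<close>.\<close>

lemma (in scalar_ideal) pf_entry_J_mat:
  "(\<Sum>k = 1..2 * n. (\<Sum>l = 1..2 * n. a l i * (sc (J_mat v l k) * 1)) * a k j) = pf_entry (- v) n a i j"
proof -
  have even: "(\<Sum>l = 1..2 * n. a l i * (sc (J_mat v l (2 * m)) * 1)) = a (2 * m - 1) i"
    if m: "m \<in> {1..n}" for m
  proof -
    have "(\<Sum>l = 1..2 * n. a l i * (sc (J_mat v l (2 * m)) * 1)) =
        (\<Sum>l = 1..2 * n. if l = 2 * m - 1 then a l i else 0)"
      by (rule sum.cong[OF refl]) (use m in \<open>auto simp: J_mat_def; presburger\<close>)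
    moreover have "2 * m - 1 \<in> {1..2 * n}" using m by auto
    ultimately show ?thesis by (simp only: sum.delta finite_atLeastAtMost if_True)
  qed
  have odd: "(\<Sum>l = 1..2 * n. a l i * (sc (J_mat v l (2 * m - 1)) * 1)) = sc (- v) * a (2 * m) i"
    if m: "m \<in> {1..n}" for m
  proof -
    have "(\<Sum>l = 1..2 * n. a l i * (sc (J_mat v l (2 * m - 1)) * 1)) =
        (\<Sum>l = 1..2 * n. if l = 2 * m then sc (- v) * a l i else 0)"
      by (rule sum.cong[OF refl]) (use m in \<open>auto simp: J_mat_def sc_comm; presburger\<close>)
    then show ?thesis using m by (simp add: sum.delta)
  qed
  show ?thesis
    unfolding sum_pairs[of _ n] pf_entry_def
  proof (rule sum.cong[OF refl])
    fix m assume "m \<in> {1..n}"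
    from even[OF this] odd[OF this]
    show "(\<Sum>m' = 1..n. a (2 * m' - 1) i * (sc (J_mat v (2 * m' - 1) (2 * m - 1)) * 1) +
          a (2 * m') i * (sc (J_mat v (2 * m') (2 * m - 1)) * 1)) * a (2 * m - 1) j +
        (\<Sum>m' = 1..n. a (2 * m' - 1) i * (sc (J_mat v (2 * m' - 1) (2 * m)) * 1) +
          a (2 * m') i * (sc (J_mat v (2 * m') (2 * m)) * 1)) * a (2 * m) j =
        a (2 * m - 1) i * a (2 * m) j + sc (- v) * (a (2 * m) i * a (2 * m - 1) j)"
      unfolding sum_pairs[of _ n] by (simp add: mult.assoc add.commute)
  qed
qed

text \<open>Serves the relators d t - 1 and t d - 1, which must lie over the generators for
  \<open>presented_algebra\<close> to apply.\<close>

lemma rdet_word_span: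
  assumes "\<And>i j. i \<in> {1..N} \<Longrightarrow> j \<in> {1..N} \<Longrightarrow> a i j \<in> word_span X"
  shows "rdet q (free_alg X) N a \<in> word_span X"
proof -
  interpret ring "free_alg X" by (rule ring_free_alg)
  have prod: "ordered_prod (free_alg X) xs \<in> word_span X" if "\<And>x. x \<in> set xs \<Longrightarrow> x \<in> word_span X" for xs
    using that
  proof (induction xs)
    case Nil
    show ?case by (simp only: ordered_prod_def foldr.simps id_apply free_alg_simps word_span_one)
  next
    case (Cons x xs)
    have "x * ordered_prod (free_alg X) xs \<in> word_span X"
      by (rule word_span_mult) (use Cons in auto)
    then show ?case by (simp only: ordered_prod_def foldr.simps o_apply free_alg_simps)
  qed
  have "rdet q (free_alg X) N a \<in> carrier (free_alg X)"
    unfolding rdet_def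
  proof (rule finsum_closed, rule Pi_I)
    fix \<sigma> assume "\<sigma> \<in> {\<sigma>. \<sigma> permutes {1..N}}"
    then have \<sigma>: "\<sigma> permutes {1..N}" by simp
    have "ordered_prod (free_alg X) (map (\<lambda>i. a i (\<sigma> i)) [1..<N + 1]) \<in> word_span X"
    proof (rule prod)
      fix x assume "x \<in> set (map (\<lambda>i. a i (\<sigma> i)) [1..<N + 1])"
      then obtain i where "i \<in> set [1..<N + 1]" and x: "x = a i (\<sigma> i)"
        by (auto simp del: upt_Suc set_upt)
      then have "i \<in> {1..N}" by auto
      then show "x \<in> word_span X"
        unfolding x by (intro assms) (simp_all only: permutes_in_image[OF \<sigma>])
    qed
    then show "(- q) ^ num_inversions N \<sigma> \<odot>\<^bsub>free_alg X\<^esub>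
        ordered_prod (free_alg X) (map (\<lambda>i. a i (\<sigma> i)) [1..<N + 1]) \<in> carrier (free_alg X)"
      unfolding free_alg_simps by (rule word_span_scale)
  qed
  then show ?thesis by (simp only: free_alg_simps)
qed

lemma gl_relators_subset: "gl_relators q N \<subseteq> word_span (gl_gens N)"
proof -
  have e: "fa_entry i j \<in> word_span (gl_gens N)" if "i \<in> {1..N}" "j \<in> {1..N}" for i j
    by (rule word_span_gen) (use that in \<open>simp add: gl_gens_def\<close>)
  have t: "fa_gen DetInv \<in> word_span (gl_gens N)"
    by (rule word_span_gen) (simp add: gl_gens_def)
  have d: "rdet q (free_alg (gl_gens N)) N fa_entry \<in> word_span (gl_gens N)"
    by (rule rdet_word_span[OF e])
  show ?thesis
    unfolding gl_relators_def qmat_relators_def Let_def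
    by (rule subsetI, elim UnE CollectE[of _ "\<lambda>u. \<exists>i. _ u i"] insertE emptyE exE conjE; hypsubst)
       (intro word_span_diff word_span_mult word_span_scale e t d word_span_one; assumption)+
qed

theorem mainTheorem4:
  fixes n :: nat and q :: complex
  assumes "n \<ge> 1" and "generic q"
  shows "let G = GL_q q (2 * n); A = GL_entry q (2 * n); AT = mat_transpose A in
      q_Pfaffian q G n
        (mat_mult G (2 * n) (mat_mult G (2 * n) AT (scalar_mat G (J_mat (- q)))) A)
      = q_Hafnian q G n
        (mat_mult G (2 * n) (mat_mult G (2 * n) A (scalar_mat G (J_mat q))) AT)
    \<and> q_Hafnian q G n
        (mat_mult G (2 * n) (mat_mult G (2 * n) A (scalar_mat G (J_mat q))) AT)
      = rdet q G (2 * n) A"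
proof -
  let ?N = "2 * n"
  let ?A = "GL_entry q ?N" and ?a = fa_entry
  have q0: "q \<noteq> 0" and unity: "q ^ k \<noteq> 1" if "k \<ge> 1" for k
    using assms(2) that by (auto simp: generic_def)
  have q: "q \<noteq> 0" using q0[of 1] by simp
  interpret presented_algebra "gl_gens ?N" "gl_relators q ?N"
    by unfold_locales (rule gl_relators_subset)
  let ?sc = "Poly_Mapping.single 0 :: complex \<Rightarrow> (gl_gen list \<Rightarrow>\<^sub>0 complex)"
  interpret K: scalar_ideal ?sc J'
    by (rule scalar_ideal_J')
  have G: "GL_q q ?N = G" by (simp only: GL_q_def G_def)
  have A: "represents (?A i j) (?a i j)" if "i \<in> {1..?N}" "j \<in> {1..?N}" for i j
    unfolding GL_entry_def using represents_gen[of "Entry i j"] that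
    by (simp only: \<pi>_def J_def) (simp add: gl_gens_def)
  then have AT: "represents (mat_transpose ?A i j) (?a j i)" if "i \<in> {1..?N}" "j \<in> {1..?N}" for i j
    using that by (simp add: mat_transpose_def)

  have relation: "K.eqv u v" if "u - v \<in> qmat_relators q (- inverse q) ?N" for u v
    unfolding K.eqv_def using that by (intro J_in_J' relator_in) (simp add: gl_relators_def Let_def)
  have qmatrix: "K.qmatrix q ?N ?a"
    unfolding K.qmatrix_def
  proof (intro conjI ballI impI)
    fix i k l assume *: "i \<in> {1..?N}" "k \<in> {1..?N}" "l \<in> {1..?N}" "k < l"
    show "K.eqv (?a i k * ?a i l) (?sc q * (?a i l * ?a i k))"
      unfolding fa_scale_eq[symmetric]
      by (rule relation) (use * in \<open>unfold qmat_relators_def Let_def, blast\<close>)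
  next
    fix i j k assume *: "i \<in> {1..?N}" "j \<in> {1..?N}" "k \<in> {1..?N}" "i < j"
    \<comment> \<open>With s = - 1/q the column factor 1/s is - q.\<close>
    have "K.eqv (?a i k * ?a j k) (fa_scale (inverse (- inverse q)) (?a j k * ?a i k))"
      by (rule relation) (use * in \<open>unfold qmat_relators_def Let_def, blast\<close>)
    then show "K.eqv (?a i k * ?a j k) (?sc (- q) * (?a j k * ?a i k))"
      by (simp add: fa_scale_eq)
  next
    fix i j k l
    assume *: "i \<in> {1..?N}" "j \<in> {1..?N}" "k \<in> {1..?N}" "l \<in> {1..?N}" "i < j" "k < l"
    \<comment> \<open>Again 1/s = - q, so both sides are multiples of q; cancelling it leaves
      anticommutation.\<close>
    have "K.eqv (fa_scale q (?a i l * ?a j k)) (fa_scale (inverse (- inverse q)) (?a j k * ?a i l))"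
      by (rule relation) (use * in \<open>unfold qmat_relators_def Let_def, blast\<close>)
    then have "K.eqv (?sc q * (?a i l * ?a j k)) (?sc q * (- (?a j k * ?a i l)))"
      by (simp add: fa_scale_eq K.sc_minus)
    then have "K.eqv (?a i l * ?a j k) (- (?a j k * ?a i l))"
      by (rule K.eqv_cancel_sc) (rule q)
    then show "K.eqv (?a j k * ?a i l) (- (?a i l * ?a j k))"
      using K.eqv_minus[OF K.eqv_sym] by fastforce
  next
    fix i j k l
    assume *: "i \<in> {1..?N}" "j \<in> {1..?N}" "k \<in> {1..?N}" "l \<in> {1..?N}" "i < j" "k < l"
    \<comment> \<open>Here r - s = q + 1/q, and the relation is solved for a_jl a_ik.\<close>
    have "K.eqv (?a i k * ?a j l - ?a j l * ?a i k) (fa_scale (q - - inverse q) (?a i l * ?a j k))"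
      by (rule relation) (use * in \<open>unfold qmat_relators_def Let_def, blast\<close>)
    then have "K.eqv (?a i k * ?a j l - (?a i k * ?a j l - ?a j l * ?a i k))
        (?a i k * ?a j l - ?sc (q + inverse q) * (?a i l * ?a j k))"
      by (intro K.eqv_diff K.eqv_refl) (simp add: fa_scale_eq)
    then show "K.eqv (?a j l * ?a i k) (?a i k * ?a j l - ?sc (q + inverse q) * (?a i l * ?a j k))"
      by simp
  qed

  have fact: "q_factorial (q ^ 4) n \<noteq> 0"
    by (rule q_factorial_nonzero) (use unity in \<open>simp flip: power_mult\<close>)
  \<comment> \<open>Squaring removes the sign: (- q^2)^(2k) = q^(4k), so if - q^2 were a root of
    unity, q would be one as well.\<close>
  have "(- (q * q)) ^ k \<noteq> 1" if "k \<ge> 1" for k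
  proof
    assume "(- (q * q)) ^ k = 1"
    then have "((- (q * q)) ^ k) ^ 2 = 1" by simp
    moreover have "((- (q * q)) ^ k) ^ 2 = q ^ (4 * k)"
      by (simp add: power_mult_distrib power2_eq_square power4_eq_xxxx power_mult add.assoc flip: power_add)
    ultimately show False using unity[of "4 * k"] that by simp
  qed
  then have transpose: "K.eqv (K.det_words q ?N (\<lambda>i j. ?a j i)) (K.det_words (- q) ?N ?a)"
    by (intro K.eqv_sym[OF K.det_words_transpose[OF q _ qmatrix]]) blast

  \<comment> \<open>Stated for any \<open>p\<close> with p^4 = q^4, so that p = q serves the
    Pfaffian and p = - q the Hafnian with one normalising factor.\<close>
  have pfaffian: "K.eqv (?sc (1 / q_factorial (q ^ 4) n) * (\<Sum>\<sigma>\<in>pair_perms n.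
      ?sc ((- p) ^ num_inversions ?N \<sigma>) *
        prod_list (map (\<lambda>i. K.pf_entry p n b (\<sigma> (2 * i - 1)) (\<sigma> (2 * i))) [1..<n + 1])))
      (K.det_words (- p) ?N b)"
    if p: "p \<noteq> 0" "p ^ 4 = q ^ 4" and b: "K.qmatrix p ?N b" for p b
  proof -
    have "?sc (1 / q_factorial (q ^ 4) n) * (?sc (q_factorial (q ^ 4) n) * u) = u" for u
      using fact by (simp add: mult.assoc[symmetric] mult_single)
    then show ?thesis
      using K.eqv_lmult[OF K.eqv_sym[OF K.pfaffian_words[OF p(1) b]], of "?sc (1 / q_factorial (q ^ 4) n)"]
      by (simp only: K.pfaffian_words_permutations p(2))
  qed

  have rdet: "represents (rdet q G ?N ?A) (K.det_words (- q) ?N ?a)"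
    unfolding K.det_words_permutations by (rule represents_rdet[OF A])
  \<comment> \<open>With B = A^T, the matrix A J_q A^T has the shape B^T J_q B; by
    \<open>pf_entry_J_mat\<close> its parameter is - q.\<close>
  have "mat_transpose (mat_transpose ?A) = ?A"
    by (simp add: mat_transpose_def)
  then have hafnian_entry: "represents
      (mat_mult G ?N (mat_mult G ?N ?A (scalar_mat G (J_mat q))) (mat_transpose ?A) i j)
      (K.pf_entry (- q) n (\<lambda>i j. ?a j i) i j)" if "i \<in> {1..?N}" "j \<in> {1..?N}" for i j
    using represents_congruence[where A = "mat_transpose ?A" and a = "\<lambda>i j. ?a j i" and V = "J_mat q", OF AT that] K.pf_entry_J_mat[where n = n and a = "\<lambda>i j. ?a j i" and v = q and i = i and j = j]
    by (simp only:)
  have hafnian: "q_Hafnian q G n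
      (mat_mult G ?N (mat_mult G ?N ?A (scalar_mat G (J_mat q))) (mat_transpose ?A)) = rdet q G ?N ?A"
    unfolding q_Hafnian_def
  proof (rule represents_eq[OF represents_pfaffian_sum[OF hafnian_entry] rdet])
    \<comment> \<open>For p = - q the signs (- p)^l become q^l, as in the Hafnian; the resulting
      determinant of the transpose is then replaced by that of A.\<close>
    have "- q \<noteq> 0" "(- q) ^ 4 = q ^ 4" using q by simp_all
    from K.eqv_trans[OF pfaffian[OF this K.qmatrix_transpose[OF qmatrix], unfolded minus_minus] transpose]
    show "K.eqv (?sc (1 / q_factorial (q ^ 4) n) * (\<Sum>\<sigma>\<in>pair_perms n.
      ?sc (q ^ num_inversions ?N \<sigma>) *
        prod_list (map (\<lambda>i. K.pf_entry (- q) n (\<lambda>i j. ?a j i) (\<sigma> (2 * i - 1)) (\<sigma> (2 * i))) [1..<n + 1])))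
      (K.det_words (- q) ?N ?a)" .
  qed

  \<comment> \<open>J_(-q) belongs to the parameter -(- q) = q, so A itself takes the role of the
    quantum matrix.\<close>
  have pfaffian_entry: "represents
      (mat_mult G ?N (mat_mult G ?N (mat_transpose ?A) (scalar_mat G (J_mat (- q)))) ?A i j)
      (K.pf_entry q n ?a i j)" if "i \<in> {1..?N}" "j \<in> {1..?N}" for i j
    using represents_congruence[where A = ?A and a = ?a and V = "J_mat (- q)", OF A that] K.pf_entry_J_mat[where n = n and a = ?a and v = "- q" and i = i and j = j]
    by (simp only: minus_minus)
  have "q_Pfaffian q G n
      (mat_mult G ?N (mat_mult G ?N (mat_transpose ?A) (scalar_mat G (J_mat (- q)))) ?A) = rdet q G ?N ?A"
    unfolding q_Pfaffian_def
    by (rule represents_eq[OF represents_pfaffian_sum[OF pfaffian_entry] rdet pfaffian[OF q refl qmatrix]])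
  with hafnian show ?thesis
    unfolding G Let_def by simp
qed

end
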